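(* Let $p,g_1,\ldots,g_m$ be real polynomials in $n$ variables, $S=\{x\in\mathbb{R}^n: g_i(x)\ge0,\ i=1,\ldots,m\}$, $p^*=\inf_{x\in S}p(x)$, and let $d,R,\eta_i,\beta$ and $f_\gamma$ be as in the context; put $N=n+m+3$, $D=2d$. For $r\ge1$ define $$l_r:=\sup\Big\{\gamma\in\mathbb{R}: f_\gamma(z)-\tfrac1r\Big(\sum_{i=1}^N z_i^2\Big)^{D}\in A^r_{N,2D}\Big\},$$ where $A^r_{N,2D}$ is the set of forms $h$ in $N$ variables of degree $2D$ such that $h(z)\cdot q(z)$ is a sum of squares of polynomials for some nonzero sum of squares form $q$ of degree $2r$. Then $l_r\le p^*$ for all $r$, $\{l_r\}$ is nondecreasing, and $\lim_{r\to\infty}l_r=p^*$.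
   Context: Data of the polynomial optimization problem $\inf_{x\in S}p(x)$: $d\ge1$ is such that $2d$ is the smallest positive even integer larger than or equal to the maximum degree of $p,g_1,\ldots,g_m$; $R>0$ satisfies $\sum_i x_i^2\le R$ for all $x\in S$; $\eta_i,\beta\in\mathbb{R}$ satisfy $g_i(x)\le\eta_i$ and $-p(x)\le\beta$ for all $x\in S$. With $z=(z_1,\ldots,z_N)=(x_1,\ldots,x_n,s_0,\ldots,s_{m+1},y)$, $$f_\gamma(z):=\left(\gamma y^{2d}-y^{2d}p(x/y)-s_0^2y^{2d-2}\right)^2+\sum_{i=1}^m\left(y^{2d}g_i(x/y)-s_i^2y^{2d-2}\right)^2+\left(\Big(R+\sum_{i=1}^m\eta_i+\beta+\gamma\Big)^dy^{2d}-\Big(\sum_{i=1}^n x_i^2+\sum_{i=0}^m s_i^2\Big)^d-s_{m+1}^{2d}\right)^2 ,$$ a form of degree $4d=2D$ in $N=n+m+3$ variables, where $y^{2d}q(x/y)$ is the degree-$2d$ homogenization of $q$. Convention: $\sup\emptyset=-\infty$. *)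

theory Defs
  imports "HOL-Analysis.Analysis" "HOL-Library.Poly_Mapping"
begin

text \<open>
  Real multivariate polynomials are finitely supported maps from monomials (finitely supported
  exponent vectors) to coefficients; \<open>HOL-Library.Poly_Mapping\<close> supplies the ring structure.
  Indeterminates are indexed by natural numbers, and those of a polynomial
  ``in \<open>N\<close> variables'' are \<open>1, \<dots>, N\<close>.
\<close>

type_synonym monom = "nat \<Rightarrow>\<^sub>0 nat"
type_synonym rpoly = "monom \<Rightarrow>\<^sub>0 real"

definition Cst :: "real \<Rightarrow> rpoly" where
  "Cst c = Poly_Mapping.single 0 c"

definition Var :: "nat \<Rightarrow> rpoly" where
  "Var i = Poly_Mapping.single (Poly_Mapping.single i 1) 1"

definition mdeg :: "monom \<Rightarrow> nat" where
  "mdeg t = (\<Sum>i\<in>Poly_Mapping.keys t. Poly_Mapping.lookup t i)"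

text \<open>The zero polynomial gets total degree \<open>0\<close>.\<close>

definition total_deg :: "rpoly \<Rightarrow> nat" where
  "total_deg q = Max (insert 0 (mdeg ` Poly_Mapping.keys q))"

definition eval_poly :: "(nat \<Rightarrow> real) \<Rightarrow> rpoly \<Rightarrow> real" where
  "eval_poly x q =
     (\<Sum>t\<in>Poly_Mapping.keys q. Poly_Mapping.lookup q t *
        (\<Prod>i\<in>Poly_Mapping.keys t. x i ^ Poly_Mapping.lookup t i))"

definition polys :: "nat \<Rightarrow> rpoly set" where
  "polys N = {q. \<forall>t\<in>Poly_Mapping.keys q. Poly_Mapping.keys t \<subseteq> {1..N}}"

text \<open>As usual, the zero polynomial is a form of every degree.\<close>

definition forms :: "nat \<Rightarrow> nat \<Rightarrow> rpoly set" where
  "forms N k = {q \<in> polys N. \<forall>t\<in>Poly_Mapping.keys q. mdeg t = k}"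

definition sos :: "nat \<Rightarrow> rpoly set" where
  "sos N = {q. \<exists>(k::nat) u. (\<forall>j<k. u j \<in> polys N) \<and> q = (\<Sum>j<k. (u j)\<^sup>2)}"

definition A_set :: "nat \<Rightarrow> nat \<Rightarrow> nat \<Rightarrow> rpoly set" where
  "A_set N k r =
     {h \<in> forms N k. \<exists>q \<in> forms N (2 * r). q \<noteq> 0 \<and> q \<in> sos N \<and> h * q \<in> sos N}"

text \<open>
  The degree-\<open>k\<close> homogenization \<open>v\<^sup>k q(x/v)\<close> of \<open>q\<close> with respect to the
  indeterminate numbered \<open>v\<close>, for \<open>total_deg q \<le> k\<close> and \<open>v\<close> not occurring in \<open>q\<close>. It is a
  polynomial, built monomial by monomial, so it is meaningful also where \<open>v\<close> vanishes.
\<close>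

definition homogenize :: "nat \<Rightarrow> nat \<Rightarrow> rpoly \<Rightarrow> rpoly" where
  "homogenize v k q =
     (\<Sum>t\<in>Poly_Mapping.keys q.
        Poly_Mapping.single (t + Poly_Mapping.single v (k - mdeg t)) (Poly_Mapping.lookup q t))"

text \<open>
  Points of \<open>\<real>\<^sup>n\<close> are extensional functions on \<open>{1..n}\<close>; the constraints are \<open>g 1, \<dots>, g m\<close>.
\<close>

definition feasible :: "nat \<Rightarrow> nat \<Rightarrow> (nat \<Rightarrow> rpoly) \<Rightarrow> (nat \<Rightarrow> real) set" where
  "feasible n m g = {x \<in> {1..n} \<rightarrow>\<^sub>E UNIV. \<forall>i\<in>{1..m}. eval_poly x (g i) \<ge> 0}"

text \<open>The infimum over an empty feasible set is \<open>\<infinity>\<close>.\<close>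

definition opt_val :: "nat \<Rightarrow> nat \<Rightarrow> rpoly \<Rightarrow> (nat \<Rightarrow> rpoly) \<Rightarrow> ereal" where
  "opt_val n m p g = (INF x\<in>feasible n m g. ereal (eval_poly x p))"

text \<open>
  The variables \<open>(x\<^sub>1, \<dots>, x\<^sub>n, s\<^sub>0, \<dots>, s\<^bsub>m+1\<^esub>, y)\<close> are numbered consecutively from \<open>1\<close>
  to \<open>n + m + 3\<close>.
\<close>

definition f_form ::
  "nat \<Rightarrow> nat \<Rightarrow> nat \<Rightarrow> real \<Rightarrow> (nat \<Rightarrow> real) \<Rightarrow> real \<Rightarrow> rpoly \<Rightarrow> (nat \<Rightarrow> rpoly) \<Rightarrow> real \<Rightarrow> rpoly"
where
  "f_form n m d R \<eta> \<beta> p g \<gamma> =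
    (let X = (\<lambda>i. Var i);
         s = (\<lambda>i. Var (n + 1 + i));
         Y = Var (n + m + 3);
         H = homogenize (n + m + 3) (2 * d)
     in (Cst \<gamma> * Y ^ (2 * d) - H p - (s 0)\<^sup>2 * Y ^ (2 * d - 2))\<^sup>2
        + (\<Sum>i=1..m. (H (g i) - (s i)\<^sup>2 * Y ^ (2 * d - 2))\<^sup>2)
        + (Cst ((R + (\<Sum>i=1..m. \<eta> i) + \<beta> + \<gamma>) ^ d) * Y ^ (2 * d)
             - ((\<Sum>i=1..n. (X i)\<^sup>2) + (\<Sum>i=0..m. (s i)\<^sup>2)) ^ d
             - s (m + 1) ^ (2 * d))\<^sup>2)"

text \<open>The supremum is taken in \<open>ereal\<close>, so it is \<open>-\<infinity>\<close> for an empty set.\<close>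

definition l_bound ::
  "nat \<Rightarrow> nat \<Rightarrow> nat \<Rightarrow> real \<Rightarrow> (nat \<Rightarrow> real) \<Rightarrow> real \<Rightarrow> rpoly \<Rightarrow> (nat \<Rightarrow> rpoly) \<Rightarrow> nat \<Rightarrow> ereal"
where
  "l_bound n m d R \<eta> \<beta> p g r =
    (let N = n + m + 3; D = 2 * d
     in Sup {ereal \<gamma> | \<gamma>::real.
          f_form n m d R \<eta> \<beta> p g \<gamma> - Cst (1 / real r) * (\<Sum>i=1..N. (Var i)\<^sup>2) ^ D
            \<in> A_set N (2 * D) r})"

end

theory Submission
  imports Defs
begin

text \<open>
  The form \<open>f\<^sub>\<gamma>\<close> is built so that it is positive definite for
  \<open>\<gamma> < p\<^sup>*\<close> and fails to be so for \<open>\<gamma> > p\<^sup>*\<close>.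
  At \<open>y = 1\<close> a zero of \<open>f\<^sub>\<gamma>\<close> is exactly a feasible point of
  value at most \<open>\<gamma>\<close>: the \<open>s\<^sub>i\<close> are square roots of the
  slacks of the constraints \<open>p \<le> \<gamma>\<close> and \<open>g\<^sub>i \<ge> 0\<close>,
  and the last square can be made to vanish because \<open>R\<close>, \<open>\<eta>\<^sub>i\<close>
  and \<open>\<beta>\<close> bound the norm and the slacks. At \<open>y = 0\<close> the last square
  alone forces all other variables to vanish, so there are no spurious zeros at infinity
  (\<open>f_pos_def\<close>, \<open>f_not_pos_def\<close>).

  If \<open>h = f\<^sub>\<gamma> - \<bar>z\<bar>\<^bsup>2D\<^esup>/r\<close> has a sum of squares
  multiple \<open>hq\<close> with \<open>q \<noteq> 0\<close> a sum of squares, then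
  \<open>h\<close> is nonnegative where \<open>q\<close> does not vanish, hence everywhere, since a
  nonzero polynomial does not vanish on any open set (\<open>nonvanishing_dense\<close>). So
  \<open>f\<^sub>\<gamma>\<close> is positive definite and \<open>\<gamma> \<le> p\<^sup>*\<close>.
  Passing from \<open>r\<close> to \<open>r' \<ge> r\<close> adds a nonnegative multiple of
  \<open>\<bar>z\<bar>\<^bsup>2D\<^esup>\<close> to \<open>h\<close>, and multiplying
  \<open>q\<close> by \<open>\<bar>z\<bar>\<^bsup>2(r'-r)\<^esup>\<close> repairs the degree of the
  multiplier, which gives monotonicity.

  For convergence, let \<open>\<gamma> < p\<^sup>*\<close>. By compactness of the sphere,
  \<open>f\<^sub>\<gamma> - \<bar>z\<bar>\<^bsup>2D\<^esup>/r\<close> is still positive definite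
  for some \<open>r\<close>, so by monotonicity it is enough that every positive definite form
  \<open>h\<close> of even degree has a multiplier of some degree
  (\<open>pos_def_in_A_set\<close>). This is Habicht's theorem. If \<open>h\<close> is even in
  every variable, then it is a form in the squares of the variables that is positive on the
  simplex, and Polya's theorem makes all coefficients of
  \<open>h\<bar>z\<bar>\<^bsup>2k\<^esup>\<close> nonnegative for large \<open>k\<close>; the
  result is a nonnegative combination of squares of monomials. In general one variable is made even
  at a time. Let \<open>h = A + B\<close> with \<open>A\<close> even and \<open>B\<close> odd in
  that variable, and put \<open>C = A\<^sup>2 - B\<^sup>2\<close>. Then \<open>A\<close> and
  \<open>C\<close> are positive definite, being \<open>(h + h')/2\<close> and \<open>h h'\<close>
  for the reflected form \<open>h'\<close>, they are even in the variable, and \<open>2 A h =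
  h\<^sup>2 + C\<close>. If \<open>A q\<^sub>1\<close> and \<open>C q\<^sub>2\<close> are sums of
  squares, then so are \<open>q = 2 A q\<^sub>1 q\<^sub>2\<close> and \<open>h q = h\<^sup>2
  q\<^sub>1 q\<^sub>2 + q\<^sub>1 (C q\<^sub>2)\<close>.
\<close>

abbreviation (input) keys where "keys \<equiv> Poly_Mapping.keys"
abbreviation (input) lookup where "lookup \<equiv> Poly_Mapping.lookup"
abbreviation (input) single where "single \<equiv> Poly_Mapping.single"

section \<open>Polynomials as functions\<close>

definition mon_val :: "(nat \<Rightarrow> real) \<Rightarrow> monom \<Rightarrow> real" where
  "mon_val x t = (\<Prod>i\<in>keys t. x i ^ lookup t i)"

lemma mon_val_superset:
  assumes "finite A" "keys t \<subseteq> A"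
  shows "mon_val x t = (\<Prod>i\<in>A. x i ^ lookup t i)"
  unfolding mon_val_def
  by (rule prod.mono_neutral_left) (use assms in \<open>auto simp: in_keys_iff\<close>)

lemma mon_val_add: "mon_val x (s + t) = mon_val x s * mon_val x t"
proof -
  let ?A = "keys s \<union> keys t"
  have "mon_val x (s + t) = (\<Prod>i\<in>?A. x i ^ lookup (s + t) i)"
    by (rule mon_val_superset) (use keys_add[of s t] in auto)
  also have "\<dots> = (\<Prod>i\<in>?A. x i ^ lookup s i) * (\<Prod>i\<in>?A. x i ^ lookup t i)"
    by (simp add: lookup_add power_add prod.distrib)
  also have "\<dots> = mon_val x s * mon_val x t"
    by (simp add: mon_val_superset[of ?A])
  finally show ?thesis .
qed

lemma mon_val_0 [simp]: "mon_val x 0 = 1"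
  by (simp add: mon_val_def)

lemma mon_val_single: "mon_val x (single i k) = x i ^ k"
  by (simp add: mon_val_def)

lemma eval_poly_mon_val: "eval_poly x q = (\<Sum>t\<in>keys q. lookup q t * mon_val x t)"
  by (simp add: eval_poly_def mon_val_def)

lemma eval_add: "eval_poly x (p + q) = eval_poly x p + eval_poly x q"
  unfolding eval_poly_mon_val
  by (rule setsum_keys_plus_distrib) (auto simp: algebra_simps)

lemma eval_0 [simp]: "eval_poly x 0 = 0"
  by (simp add: eval_poly_def)

lemma eval_diff: "eval_poly x (p - q) = eval_poly x p - eval_poly x q"
  using eval_add[of x "p - q" q] by simp

lemma eval_sum: "eval_poly x (\<Sum>i\<in>I. f i) = (\<Sum>i\<in>I. eval_poly x (f i))"
  by (induction I rule: infinite_finite_induct) (auto simp: eval_add)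

lemma eval_single: "eval_poly x (single t c) = c * mon_val x t"
  by (simp add: eval_poly_mon_val)

lemma poly_eq_sum_monomials: "q = (\<Sum>t\<in>keys q. single t (lookup q t))"
  for q :: rpoly
proof (rule poly_mapping_eqI)
  fix s
  have "lookup (\<Sum>t\<in>keys q. single t (lookup q t)) s
      = (\<Sum>t\<in>keys q. if t = s then lookup q s else 0)"
    unfolding lookup_sum by (rule sum.cong) (auto simp: lookup_single)
  also have "\<dots> = lookup q s"
    by (simp add: in_keys_iff)
  finally show "lookup q s = lookup (\<Sum>t\<in>keys q. single t (lookup q t)) s" ..
qed

lemma eval_mult: "eval_poly x (p * q) = eval_poly x p * eval_poly x q"
proof -
  have "eval_poly x (p * q) = eval_poly x
      ((\<Sum>t\<in>keys p. single t (lookup p t)) * (\<Sum>t\<in>keys q. single t (lookup q t)))"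
    by (metis poly_eq_sum_monomials)
  also have "\<dots> = (\<Sum>s\<in>keys p. \<Sum>t\<in>keys q.
      (lookup p s * mon_val x s) * (lookup q t * mon_val x t))"
    by (simp add: sum_product eval_sum mult_single eval_single mon_val_add mult_ac)
  also have "\<dots> = eval_poly x p * eval_poly x q"
    by (simp add: sum_product eval_poly_mon_val)
  finally show ?thesis .
qed

lemma eval_Cst [simp]: "eval_poly x (Cst c) = c"
  by (simp add: Cst_def eval_single)

lemma eval_Var [simp]: "eval_poly x (Var i) = x i"
  by (simp add: Var_def eval_single mon_val_single)

lemma eval_1 [simp]: "eval_poly x 1 = 1"
  using eval_Cst[of x 1] by (simp add: Cst_def single_one)

lemma eval_power: "eval_poly x (p ^ k) = eval_poly x p ^ k"
  by (induction k) (auto simp: eval_mult)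

lemma eval_prod: "eval_poly x (\<Prod>i\<in>I. f i) = (\<Prod>i\<in>I. eval_poly x (f i))"
  by (induction I rule: infinite_finite_induct) (auto simp: eval_mult)

lemmas eval_ring = eval_add eval_diff eval_sum eval_mult eval_power eval_prod

lemma eval_cong:
  assumes "q \<in> polys N" "\<And>i. i \<in> {1..N} \<Longrightarrow> x i = y i"
  shows "eval_poly x q = eval_poly y q"
  unfolding eval_poly_def
proof (rule sum.cong[OF refl])
  fix t assume "t \<in> keys q"
  then have "keys t \<subseteq> {1..N}"
    using assms(1) by (auto simp: polys_def)
  then have "(\<Prod>i\<in>keys t. x i ^ lookup t i) = (\<Prod>i\<in>keys t. y i ^ lookup t i)"
    using assms(2) by (intro prod.cong) auto
  then show "lookup q t * (\<Prod>i\<in>keys t. x i ^ lookup t i)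
      = lookup q t * (\<Prod>i\<in>keys t. y i ^ lookup t i)"
    by simp
qed

section \<open>Density of the nonvanishing locus\<close>

text \<open>
  Induction over the set of variables: collecting the powers of one variable \<open>x\<^sub>j\<close>, the sum becomes
  a univariate polynomial with infinitely many roots, so each of its coefficients, which are sums
  of the same kind in the remaining variables, vanishes near the point as well.
\<close>

lemma exponent_sum_vanishes_near:
  fixes T :: "(nat \<Rightarrow> nat) set" and c :: "(nat \<Rightarrow> nat) \<Rightarrow> real"
  assumes "finite I" "finite T" "\<And>t i. t \<in> T \<Longrightarrow> i \<notin> I \<Longrightarrow> t i = 0" "e > 0"
    and "\<And>x. (\<forall>i. \<bar>x i - z i\<bar> < e) \<Longrightarrow> (\<Sum>t\<in>T. c t * (\<Prod>i\<in>I. x i ^ t i)) = 0"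
    and "t \<in> T"
  shows "c t = 0"
  using assms
proof (induction I arbitrary: T c t rule: finite_induct)
  case empty
  have "T = {t}"
  proof (intro equalityI subsetI)
    fix s assume "s \<in> T"
    then have "s = t"
      using empty.prems(2,5) by (intro ext) (metis empty_iff)
    then show "s \<in> {t}" by simp
  qed (use empty.prems(5) in simp)
  then show ?case
    using empty.prems(4)[of z] empty.prems(3) by simp
next
  case (insert j I)
  \<comment> \<open>the exponents with power \<open>k\<close> of the variable \<open>x\<^sub>j\<close>; \<open>b x k\<close> below is the coefficient of \<open>x\<^sub>j\<^sup>k\<close>\<close>
  define T' where "T' k = {s \<in> T. s j = k}" for k
  have fin: "finite (T' k)" for k
    using insert.prems(1) by (simp add: T'_def)
  define b where "b x k = (\<Sum>s\<in>T' k. c s * (\<Prod>i\<in>I. x i ^ s i))" for x :: "nat \<Rightarrow> real" and k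
  define m where "m = Max ((\<lambda>s. s j) ` T)"
  have m: "s j \<le> m" if "s \<in> T" for s
    using that insert.prems(1) by (simp add: m_def)
  have b0: "b x k = 0" if x: "\<forall>i. \<bar>x i - z i\<bar> < e" for x k
  proof -
    have "(\<Sum>k\<le>m. b x k * v ^ k) = 0" if v: "v \<in> {z j - e<..<z j + e}" for v
    proof -
      have xj: "(\<Prod>i\<in>I. (x(j := v)) i ^ s i) = (\<Prod>i\<in>I. x i ^ s i)" for s
        using insert.hyps by (intro prod.cong) auto
      have "0 = (\<Sum>s\<in>T. c s * (\<Prod>i\<in>insert j I. (x(j := v)) i ^ s i))"
        using x v by (intro insert.prems(4)[symmetric]) auto
      also have "\<dots> = (\<Sum>s\<in>T. c s * (\<Prod>i\<in>I. x i ^ s i) * v ^ s j)"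
        unfolding prod.insert[OF insert.hyps] xj by (simp add: mult_ac)
      also have "\<dots> = (\<Sum>k\<le>m. \<Sum>s\<in>T' k. c s * (\<Prod>i\<in>I. x i ^ s i) * v ^ s j)"
        unfolding T'_def
        by (rule sum.group[symmetric]) (use insert.prems(1) m in auto)
      also have "\<dots> = (\<Sum>k\<le>m. b x k * v ^ k)"
        unfolding b_def sum_distrib_right
        by (intro sum.cong) (auto simp: T'_def)
      finally show ?thesis ..
    qed
    then have "{z j - e<..<z j + e} \<subseteq> {v. (\<Sum>k\<le>m. b x k * v ^ k) = 0}"
      by blast
    moreover have "infinite {z j - e<..<z j + e}"
      using \<open>e > 0\<close> by (simp add: infinite_Ioo)
    ultimately have "infinite {v. (\<Sum>k\<le>m. b x k * v ^ k) = 0}"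
      using finite_subset by blast
    then have "\<forall>k\<le>m. b x k = 0"
      unfolding polyfun_finite_roots by blast
    moreover have "b x k = 0" if "k > m"
    proof -
      have "T' k = {}" using m that by (fastforce simp: T'_def)
      then show ?thesis by (simp add: b_def)
    qed
    ultimately show ?thesis
      by (meson not_le)
  qed
  \<comment> \<open>erasing the exponent at \<open>j\<close> makes the induction hypothesis applicable and loses nothing where that exponent is fixed\<close>
  let ?r = "\<lambda>s. s(j := 0::nat)" and ?k = "t j"
  have inj: "inj_on ?r (T' ?k)"
    by (rule inj_onI) (simp add: T'_def, metis fun_upd_triv fun_upd_upd)
  define c' where "c' u = c (u(j := ?k))" for u
  have cc: "c' (?r s) = c s" if "s \<in> T' ?k" for s
    using that unfolding c'_def T'_def by (simp add: fun_upd_idem)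
  have "c' (?r t) = 0"
  proof (rule insert.IH[where T = "?r ` T' ?k" and c = c' and t = "?r t"])
    show "finite (?r ` T' ?k)" using fin by simp
    show "?r t \<in> ?r ` T' ?k" using insert.prems(5) by (auto simp: T'_def)
    show "u i = 0" if "u \<in> ?r ` T' ?k" "i \<notin> I" for u i
      using that insert.prems(2) by (auto simp: T'_def)
    show "e > 0" by fact
    fix x :: "nat \<Rightarrow> real" assume x: "\<forall>i. \<bar>x i - z i\<bar> < e"
    have "(\<Sum>u\<in>?r ` T' ?k. c' u * (\<Prod>i\<in>I. x i ^ u i))
        = (\<Sum>s\<in>T' ?k. c s * (\<Prod>i\<in>I. x i ^ (?r s) i))"
      using inj by (simp add: sum.reindex cc)
    also have "\<dots> = b x ?k"
      unfolding b_def using insert.hyps by (intro sum.cong arg_cong2[of _ _ _ _ "(*)"] prod.cong) auto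
    finally show "(\<Sum>u\<in>?r ` T' ?k. c' u * (\<Prod>i\<in>I. x i ^ u i)) = 0"
      using b0[OF x] by simp
  qed
  then show ?case
    using cc[of t] insert.prems(5) by (simp add: T'_def)
qed

lemma nonvanishing_dense:
  assumes "q \<noteq> 0" "e > 0"
  obtains x where "\<forall>i. \<bar>x i - z i\<bar> < e" "eval_poly x q \<noteq> 0"
proof -
  have "\<exists>x. (\<forall>i. \<bar>x i - z i\<bar> < e) \<and> eval_poly x q \<noteq> 0"
  proof (rule ccontr)
    assume neg: "\<not> ?thesis"
    define I where "I = (\<Union>t\<in>keys q. keys t)"
    obtain t where t: "t \<in> keys q"
      by (metis assms(1) all_not_in_conv poly_eq_sum_monomials sum.empty)
    have inj: "inj_on lookup (keys q)"
      by (rule inj_onI) (simp add: lookup_inject)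
    \<comment> \<open>coefficients reindexed by plain exponent functions\<close>
    define c where "c u = lookup q (inv_into (keys q) lookup u)" for u
    have c: "c (lookup s) = lookup q s" if "s \<in> keys q" for s
      using inj that by (simp add: c_def)
    have "c (lookup t) = 0"
    proof (rule exponent_sum_vanishes_near[of I "lookup ` keys q" e z c])
      show "finite I" by (simp add: I_def)
      show "finite (lookup ` keys q)" by simp
      show "lookup t \<in> lookup ` keys q" using t by simp
      show "e > 0" by fact
      show "u i = 0" if "u \<in> lookup ` keys q" "i \<notin> I" for u i
        using that by (auto simp: I_def in_keys_iff)
      fix x :: "nat \<Rightarrow> real" assume x: "\<forall>i. \<bar>x i - z i\<bar> < e"
      have "(\<Sum>u\<in>lookup ` keys q. c u * (\<Prod>i\<in>I. x i ^ u i))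
          = (\<Sum>s\<in>keys q. lookup q s * (\<Prod>i\<in>I. x i ^ lookup s i))"
        using inj by (simp add: sum.reindex c)
      also have "\<dots> = eval_poly x q"
        unfolding eval_poly_mon_val
        by (intro sum.cong refl) (subst mon_val_superset[of I], auto simp: I_def)
      finally show "(\<Sum>u\<in>lookup ` keys q. c u * (\<Prod>i\<in>I. x i ^ u i)) = 0"
        using neg x by auto
    qed
    then show False
      using c[OF t] t by (simp add: in_keys_iff)
  qed
  then show ?thesis using that by blast
qed

lemma eval_inject:
  assumes "\<And>x. eval_poly x p = eval_poly x q"
  shows "p = q"
  by (metis assms eq_iff_diff_eq_0 eval_diff nonvanishing_dense zero_less_one)

lemma tendsto_eval:
  assumes "\<And>i. (\<lambda>k. X k i) \<longlonglongrightarrow> z i"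
  shows "(\<lambda>k. eval_poly (X k) q) \<longlonglongrightarrow> eval_poly z q"
  unfolding eval_poly_def by (intro tendsto_intros assms)

text \<open>
  The multiplier \<open>q\<close> may vanish at \<open>z\<close>. There \<open>z\<close> is approximated by points at which \<open>q\<close> is
  positive and where the sign of \<open>h\<close> is therefore that of \<open>h * q\<close>.
\<close>

lemma nonneg_of_mult_nonneg:
  assumes "q \<noteq> 0" "\<And>x. eval_poly x q \<ge> 0" "\<And>x. eval_poly x (h * q) \<ge> 0"
  shows "eval_poly z h \<ge> 0"
proof -
  have "\<exists>x. (\<forall>i. \<bar>x i - z i\<bar> < 1 / Suc k) \<and> eval_poly x q \<noteq> 0" for k
    using nonvanishing_dense[OF assms(1), of "1 / Suc k" z] by (metis of_nat_0_less_iff zero_less_Suc zero_less_divide_1_iff)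
  then obtain X where X: "\<And>k i. \<bar>X k i - z i\<bar> < 1 / Suc k" "\<And>k. eval_poly (X k) q \<noteq> 0"
    by metis
  have "(\<lambda>k. X k i) \<longlonglongrightarrow> z i" for i
  proof -
    have "(\<lambda>k. X k i - z i) \<longlonglongrightarrow> 0"
      by (rule Lim_null_comparison[OF _ LIMSEQ_inverse_real_of_nat])
        (use X(1) less_imp_le in \<open>auto simp: inverse_eq_divide intro!: eventuallyI\<close>)
    then show ?thesis by (simp add: LIM_zero_iff)
  qed
  then have "(\<lambda>k. eval_poly (X k) h) \<longlonglongrightarrow> eval_poly z h"
    by (rule tendsto_eval)
  moreover have "eval_poly (X k) h \<ge> 0" for k
  proof -
    have "eval_poly (X k) q > 0" using assms(2)[of "X k"] X(2)[of k] by linarith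
    then show ?thesis using assms(3)[of "X k"] by (simp add: eval_mult zero_le_mult_iff)
  qed
  ultimately show ?thesis
    by (meson LIMSEQ_le_const)
qed

section \<open>Forms and sums of squares\<close>

lemma keys_multE:
  assumes "t \<in> keys (p * q)"
  obtains a b where "a \<in> keys p" "b \<in> keys q" "t = a + b"
  using keys_mult[of p q] assms by blast

lemma mdeg_superset:
  assumes "finite A" "keys t \<subseteq> A"
  shows "mdeg t = (\<Sum>i\<in>A. lookup t i)"
  unfolding mdeg_def
  by (rule sum.mono_neutral_left) (use assms in \<open>auto simp: in_keys_iff\<close>)

lemma mdeg_add: "mdeg (s + t) = mdeg s + mdeg t"
proof -
  let ?A = "keys s \<union> keys t"
  have "mdeg (s + t) = (\<Sum>i\<in>?A. lookup (s + t) i)"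
    by (rule mdeg_superset) (use keys_add[of s t] in auto)
  also have "\<dots> = mdeg s + mdeg t"
    by (simp add: lookup_add sum.distrib mdeg_superset[of ?A])
  finally show ?thesis .
qed

lemma polys_Cst [simp]: "Cst c \<in> polys N"
  by (simp add: polys_def Cst_def)

lemma polys_1 [simp]: "1 \<in> polys N"
  by (simp add: polys_def)

lemma polys_Var: "i \<in> {1..N} \<Longrightarrow> Var i \<in> polys N"
  by (simp add: polys_def Var_def)

lemma polys_mult: "p \<in> polys N \<Longrightarrow> q \<in> polys N \<Longrightarrow> p * q \<in> polys N"
  unfolding polys_def by (fastforce elim!: keys_multE dest: keys_add[THEN subsetD])

lemma polys_power: "p \<in> polys N \<Longrightarrow> p ^ k \<in> polys N"
  by (induction k) (auto intro: polys_mult)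

lemma polys_prod: "(\<And>i. i \<in> I \<Longrightarrow> f i \<in> polys N) \<Longrightarrow> (\<Prod>i\<in>I. f i) \<in> polys N"
  by (induction I rule: infinite_finite_induct) (auto intro: polys_mult)

lemma forms_polys: "q \<in> forms N k \<Longrightarrow> q \<in> polys N"
  by (simp add: forms_def)

lemma forms_0 [simp]: "0 \<in> forms N k"
  by (simp add: forms_def polys_def)

lemma forms_add: "p \<in> forms N k \<Longrightarrow> q \<in> forms N k \<Longrightarrow> p + q \<in> forms N k"
  unfolding forms_def polys_def using keys_add[of p q] by blast

lemma keys_minus: "keys (p - q) \<subseteq> keys p \<union> keys q" for p q :: rpoly
  by (auto simp: in_keys_iff lookup_minus)

lemma forms_diff: "p \<in> forms N k \<Longrightarrow> q \<in> forms N k \<Longrightarrow> p - q \<in> forms N k"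
  unfolding forms_def polys_def using keys_minus[of p q] by blast

lemma forms_sum: "(\<And>i. i \<in> I \<Longrightarrow> f i \<in> forms N k) \<Longrightarrow> (\<Sum>i\<in>I. f i) \<in> forms N k"
  by (induction I rule: infinite_finite_induct) (auto intro: forms_add)

lemma forms_mult: "p \<in> forms N a \<Longrightarrow> q \<in> forms N b \<Longrightarrow> p * q \<in> forms N (a + b)"
  using polys_mult[of p N q] unfolding forms_def by (auto elim!: keys_multE simp: mdeg_add)

lemma forms_Cst: "Cst c \<in> forms N 0"
  by (simp add: forms_def Cst_def polys_def mdeg_def)

lemma forms_Var: "i \<in> {1..N} \<Longrightarrow> Var i \<in> forms N 1"
  using polys_Var[of i N] by (simp add: forms_def Var_def mdeg_def)

lemma forms_power:
  assumes "p \<in> forms N a"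
  shows "p ^ k \<in> forms N (k * a)"
proof (induction k)
  case 0
  then show ?case using forms_Cst[of 1 N] by (simp add: Cst_def)
next
  case (Suc k)
  then show ?case using forms_mult[OF assms Suc] by simp
qed

lemma forms_Cst_mult: "p \<in> forms N k \<Longrightarrow> Cst c * p \<in> forms N k"
  using forms_mult[OF forms_Cst[of c N]] by force

lemma eval_form_scale:
  assumes "q \<in> forms N k"
  shows "eval_poly (\<lambda>i. c * x i) q = c ^ k * eval_poly x q"
proof -
  have "mon_val (\<lambda>i. c * x i) t = c ^ mdeg t * mon_val x t" for t
    by (simp add: mon_val_def mdeg_def power_mult_distrib prod.distrib power_sum)
  moreover have "mdeg t = k" if "t \<in> keys q" for t
    using assms that by (simp add: forms_def)
  ultimately show ?thesis
    by (simp add: eval_poly_mon_val sum_distrib_left mult_ac)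
qed

lemma sos_0 [simp]: "0 \<in> sos N"
  unfolding sos_def by (auto intro!: exI[of _ "0::nat"])

lemma sos_square: "u \<in> polys N \<Longrightarrow> u\<^sup>2 \<in> sos N"
  unfolding sos_def by (auto intro!: exI[of _ "1::nat"] exI[of _ "\<lambda>_. u"])

lemma sos_add_square:
  assumes "p \<in> sos N" "v \<in> polys N"
  shows "p + v\<^sup>2 \<in> sos N"
proof -
  obtain k :: nat and u where u: "\<forall>j<k. u j \<in> polys N" "p = (\<Sum>j<k. (u j)\<^sup>2)"
    using assms(1) unfolding sos_def by blast
  let ?u = "u(k := v)"
  have "(\<Sum>j<Suc k. (?u j)\<^sup>2) = p + v\<^sup>2"
    by (simp add: u(2))
  moreover have "\<forall>j<Suc k. ?u j \<in> polys N"
    using u(1) assms(2) by (simp add: less_Suc_eq)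
  ultimately show ?thesis
    unfolding sos_def by (intro CollectI exI[of _ "Suc k"] exI[of _ ?u] conjI) simp_all
qed

lemma sos_induct [consumes 1, case_names zero add_square]:
  assumes "q \<in> sos N" "P 0"
    "\<And>p u. p \<in> sos N \<Longrightarrow> P p \<Longrightarrow> u \<in> polys N \<Longrightarrow> P (p + u\<^sup>2)"
  shows "P q"
proof -
  obtain k :: nat and u where u: "\<forall>j<k. u j \<in> polys N" "q = (\<Sum>j<k. (u j)\<^sup>2)"
    using assms(1) unfolding sos_def by blast
  have "l \<le> k \<Longrightarrow> (\<Sum>j<l. (u j)\<^sup>2) \<in> sos N \<and> P (\<Sum>j<l. (u j)\<^sup>2)" for l
    by (induction l) (use u(1) assms(2,3) in \<open>auto intro: sos_add_square\<close>)
  then show ?thesis using u(2) by blast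
qed

lemma sos_add:
  assumes "p \<in> sos N" "q \<in> sos N"
  shows "p + q \<in> sos N"
  using assms(2)
proof (induction q rule: sos_induct)
  case (add_square q u)
  then show ?case using sos_add_square[of "p + q" N u] assms(1) by (simp add: add.assoc)
qed (simp add: assms(1))

lemma sos_sum: "(\<And>i. i \<in> I \<Longrightarrow> f i \<in> sos N) \<Longrightarrow> (\<Sum>i\<in>I. f i) \<in> sos N"
  by (induction I rule: infinite_finite_induct) (auto intro: sos_add)

lemma sos_mult_square: "p \<in> sos N \<Longrightarrow> v \<in> polys N \<Longrightarrow> p * v\<^sup>2 \<in> sos N"
proof (induction p rule: sos_induct)
  case (add_square p u)
  then have "p * v\<^sup>2 + (u * v)\<^sup>2 \<in> sos N"
    by (intro sos_add_square polys_mult) auto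
  then show ?case by (simp add: distrib_right power_mult_distrib)
qed simp

lemma sos_mult:
  assumes "p \<in> sos N" "q \<in> sos N"
  shows "p * q \<in> sos N"
  using assms(2)
proof (induction q rule: sos_induct)
  case (add_square q u)
  then have "p * q + p * u\<^sup>2 \<in> sos N"
    using assms(1) by (intro sos_add sos_mult_square) auto
  then show ?case by (simp add: distrib_left)
qed simp

lemma Cst_mult: "Cst a * Cst b = Cst (a * b)"
  by (simp add: Cst_def mult_single)

lemma Cst_diff: "Cst a - Cst b = Cst (a - b)"
  by (simp add: Cst_def single_diff)

lemma sos_Cst:
  assumes "c \<ge> 0"
  shows "Cst c \<in> sos N"
proof -
  have "Cst c = (Cst (sqrt c))\<^sup>2"
    using assms by (simp add: power2_eq_square Cst_mult)
  then show ?thesis by (simp add: sos_square)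
qed

lemma sos_power: "p \<in> sos N \<Longrightarrow> p ^ k \<in> sos N"
  using sos_Cst[of 1 N] by (induction k) (auto intro: sos_mult simp: Cst_def)

lemma sos_nonneg: "q \<in> sos N \<Longrightarrow> eval_poly x q \<ge> 0"
  by (induction q rule: sos_induct) (auto simp: eval_ring)

definition sqnorm :: "nat \<Rightarrow> rpoly" where
  "sqnorm N = (\<Sum>i=1..N. (Var i)\<^sup>2)"

lemma sqnorm_forms: "sqnorm N \<in> forms N 2"
  unfolding sqnorm_def using forms_power[OF forms_Var, of _ N 2] by (intro forms_sum) auto

lemma sqnorm_power_forms: "sqnorm N ^ k \<in> forms N (2 * k)"
  using forms_power[OF sqnorm_forms, of N k] by (simp add: mult.commute)

lemma sqnorm_sos: "sqnorm N \<in> sos N"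
  unfolding sqnorm_def by (intro sos_sum sos_square polys_Var)

lemma eval_sqnorm: "eval_poly x (sqnorm N) = (\<Sum>i=1..N. (x i)\<^sup>2)"
  by (simp add: sqnorm_def eval_ring)

lemma sqnorm_nonzero:
  assumes "N \<ge> 1"
  shows "sqnorm N \<noteq> 0"
proof
  assume "sqnorm N = 0"
  then have "(\<Sum>i=1..N. (1::real)) = 0"
    using eval_sqnorm[of "\<lambda>_. 1" N] by simp
  then show False using assms by simp
qed

lemma sqnorm_pos:
  assumes "\<exists>i\<in>{1..N}. x i \<noteq> 0"
  shows "eval_poly x (sqnorm N) > 0"
  unfolding eval_sqnorm using assms by (auto intro!: sum_pos2)

section \<open>Positive definite forms\<close>

definition pos_def :: "nat \<Rightarrow> rpoly \<Rightarrow> bool" where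
  "pos_def N h \<longleftrightarrow> (\<forall>x. (\<exists>i\<in>{1..N}. x i \<noteq> 0) \<longrightarrow> eval_poly x h > 0)"

lemma pos_defD: "pos_def N h \<Longrightarrow> i \<in> {1..N} \<Longrightarrow> x i \<noteq> 0 \<Longrightarrow> eval_poly x h > 0"
  unfolding pos_def_def by blast

lemma continuous_on_eval: "continuous_on A (\<lambda>x. eval_poly x q)"
proof -
  have "continuous_on UNIV (\<lambda>x. eval_poly x q)"
    unfolding eval_poly_def by (intro continuous_on_sum continuous_on_mult continuous_on_const
        continuous_on_prod continuous_on_power continuous_on_product_coordinates)
  then show ?thesis using continuous_on_subset by blast
qed

text \<open>
  The minimum over the unit sphere is attained. Points have infinitely many coordinates; to have a
  compact sphere in the product topology, those beyond \<open>N\<close>, which do not affect the value of \<open>h\<close>,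
  are fixed to be \<open>0\<close>.
\<close>

lemma pos_def_bounded_below:
  assumes "h \<in> polys N" "pos_def N h" "N \<ge> 1"
  obtains m where "m > 0" "\<And>x. (\<Sum>i=1..N. (x i)\<^sup>2) = 1 \<Longrightarrow> eval_poly x h \<ge> m"
proof -
  define B where "B = Pi\<^sub>E UNIV (\<lambda>i. if i \<in> {1..N} then {-1..1::real} else {0})"
  define K where "K = B \<inter> {x. eval_poly x (sqnorm N) = 1}"
  have "compactin (product_topology (\<lambda>i. euclidean) UNIV) B"
    unfolding B_def compactin_PiE by simp
  then have "compact B"
    by (simp add: euclidean_product_topology)
  moreover have "closed {x. eval_poly x (sqnorm N) = 1}"
    by (intro closed_Collect_eq continuous_on_eval continuous_on_const)
  ultimately have "compact K"
    unfolding K_def by (rule compact_Int_closed)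
  moreover have "(\<lambda>i. if i = 1 then 1 else 0) \<in> K"
    using assms(3) by (auto simp: K_def B_def eval_sqnorm if_distrib[of "\<lambda>x. x\<^sup>2"] cong: if_cong)
  ultimately obtain w where w: "w \<in> K" "\<And>x. x \<in> K \<Longrightarrow> eval_poly w h \<le> eval_poly x h"
    using continuous_attains_inf[of K "\<lambda>x. eval_poly x h"] continuous_on_eval by blast
  have "eval_poly w h > 0"
  proof -
    have "(\<Sum>i=1..N. (w i)\<^sup>2) \<noteq> 0"
      using w(1) by (simp add: K_def eval_sqnorm)
    then obtain i where "i \<in> {1..N}" "w i \<noteq> 0"
      by (metis sum.neutral zero_power2)
    then show ?thesis using assms(2) pos_defD by blast
  qed
  moreover have "eval_poly w h \<le> eval_poly x h" if x: "(\<Sum>i=1..N. (x i)\<^sup>2) = 1" for x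
  proof -
    let ?y = "\<lambda>i. if i \<in> {1..N} then x i else 0"
    have "\<bar>x i\<bar> \<le> 1" if i: "i \<in> {1..N}" for i
    proof -
      have "(x i)\<^sup>2 \<le> (\<Sum>i=1..N. (x i)\<^sup>2)"
        using i by (intro member_le_sum) auto
      then show ?thesis using x by (simp add: abs_square_le_1)
    qed
    then have "?y \<in> B"
      by (auto simp: B_def abs_le_iff minus_le_iff)
    then have "?y \<in> K"
      using x by (simp add: K_def eval_cong[OF forms_polys[OF sqnorm_forms], of N ?y x] eval_sqnorm)
    moreover have "eval_poly ?y h = eval_poly x h"
      by (rule eval_cong[OF assms(1)]) simp
    ultimately show ?thesis using w(2) by metis
  qed
  ultimately show ?thesis using that by blast
qed

section \<open>Polya's theorem\<close>

text \<open>
  Exponent vectors are extensional functions, so that equality of exponents on \<open>I\<close> is equality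
  of functions and sums over the set have no repetitions.
\<close>

definition exponents :: "nat set \<Rightarrow> nat \<Rightarrow> (nat \<Rightarrow> nat) set" where
  "exponents I k = {a \<in> I \<rightarrow>\<^sub>E UNIV. sum a I = k}"

lemma finite_exponents:
  assumes "finite I"
  shows "finite (exponents I k)"
proof (rule finite_subset)
  show "exponents I k \<subseteq> I \<rightarrow>\<^sub>E {..k}"
  proof
    fix a assume a: "a \<in> exponents I k"
    then have "a i \<le> k" if "i \<in> I" for i
      using that assms member_le_sum[of i I a] by (auto simp: exponents_def)
    then show "a \<in> I \<rightarrow>\<^sub>E {..k}"
      using a by (simp add: exponents_def PiE_iff)
  qed
  show "finite (I \<rightarrow>\<^sub>E {..k})"
    using assms by (intro finite_PiE) auto
qed

lemma multinomial:
  fixes x :: "nat \<Rightarrow> real"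
  assumes "finite I"
  shows "(\<Sum>i\<in>I. x i) ^ k
    = (\<Sum>a\<in>exponents I k. fact k / (\<Prod>i\<in>I. fact (a i)) * (\<Prod>i\<in>I. x i ^ a i))"
  using assms
proof (induction I arbitrary: k rule: finite_induct)
  case empty
  have "exponents {} k = (if k = 0 then {\<lambda>_. undefined} else {})"
    by (auto simp: exponents_def)
  then show ?case by simp
next
  case (insert j I)
  let ?F = "\<lambda>J k a. fact k / (\<Prod>i\<in>J. fact (a i)) * (\<Prod>i\<in>J. x i ^ a i)"
  have upd: "(\<Prod>i\<in>I. f i ((a(j := l)) i)) = (\<Prod>i\<in>I. f i (a i))"
    for f :: "nat \<Rightarrow> nat \<Rightarrow> real" and a l
    using insert.hyps by (intro prod.cong) auto
  have upd_sum: "sum (a(j := l)) I = sum a I" for a :: "nat \<Rightarrow> nat" and l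
    using insert.hyps by (intro sum.cong) auto
  \<comment> \<open>exponents on \<open>insert j I\<close> correspond to the exponent \<open>l\<close> at \<open>j\<close> of the binomial expansion and exponents on \<open>I\<close>\<close>
  have term_eq: "real (k choose l) * x j ^ l * ?F I (k - l) a = ?F (insert j I) k (a(j := l))"
    if "l \<le> k" for l a
    using that insert.hyps upd[of "\<lambda>_. fact" a l] upd[of "\<lambda>i. (^) (x i)" a l]
    by (simp add: binomial_fact del: fun_upd_apply) simp
  have "(\<Sum>i\<in>insert j I. x i) ^ k = (\<Sum>l\<le>k. real (k choose l) * x j ^ l * (\<Sum>i\<in>I. x i) ^ (k - l))"
    using insert.hyps by (simp add: binomial_ring)
  also have "\<dots> = (\<Sum>l\<le>k. \<Sum>a\<in>exponents I (k - l). ?F (insert j I) k (a(j := l)))"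
    unfolding insert.IH sum_distrib_left using term_eq by (intro sum.cong) auto
  also have "\<dots> = (\<Sum>(l, a)\<in>Sigma {..k} (\<lambda>l. exponents I (k - l)). ?F (insert j I) k (a(j := l)))"
    using insert.hyps by (intro sum.Sigma) (auto simp: finite_exponents)
  also have "\<dots> = (\<Sum>a\<in>exponents (insert j I) k. ?F (insert j I) k a)"
    by (rule sum.reindex_bij_witness[where
          i = "\<lambda>a. (a j, a(j := undefined))" and j = "\<lambda>(l, a). a(j := l)"])
      (use insert.hyps upd_sum in \<open>auto simp: exponents_def PiE_iff extensional_def fun_eq_iff\<close>)
  finally show ?case .
qed

text \<open>
  The falling factorial \<open>a (a - 1) \<cdots> (a - b + 1)\<close>, which vanishes for \<open>a < b\<close>.
\<close>

definition falling :: "nat \<Rightarrow> nat \<Rightarrow> real" where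
  "falling a b = (\<Prod>j<b. real a - real j)"

lemma falling_eq_0: "a < b \<Longrightarrow> falling a b = 0"
  unfolding falling_def by (rule prod_zero) auto

lemma falling_add: "falling (c + b) b / fact (c + b) = 1 / fact c"
proof (induction b arbitrary: c)
  case 0
  then show ?case by (simp add: falling_def)
next
  case (Suc b)
  have "falling (c + Suc b) (Suc b) = falling (Suc c + b) b * (1 + real c)"
    by (simp add: falling_def)
  then have "falling (c + Suc b) (Suc b) / fact (c + Suc b)
      = falling (Suc c + b) b / fact (Suc c + b) * (1 + real c)"
    by simp
  also have "\<dots> = 1 / fact c"
  proof -
    have "1 + real c \<noteq> 0" by linarith
    then show ?thesis
      unfolding Suc by (simp add: add.commute)
  qed
  finally show ?case .
qed

text \<open>
  In the multinomial expansion of the power, \<open>x\<^sup>c\<close> contributes to \<open>x\<^bsup>c+b\<^esup>\<close> with coefficient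
  \<open>k!/c!\<close>. With \<open>a = c + b\<close> this is \<open>k!/a!\<close> times falling factorials of the \<open>a\<^sub>i\<close>, and these vanish
  for the \<open>a\<close> that are not of this form. Thus the coefficient at \<open>a\<close> is the product of a positive
  factor independent of \<open>b\<close> and a quantity close to the value of the monomial \<open>x\<^sup>b\<close> at \<open>a\<close>.
\<close>

lemma monomial_times_sum_power:
  fixes x :: "nat \<Rightarrow> real"
  assumes "finite I" "sum b I = e"
  shows "(\<Prod>i\<in>I. x i ^ b i) * (\<Sum>i\<in>I. x i) ^ k
    = (\<Sum>a\<in>exponents I (k + e). fact k / (\<Prod>i\<in>I. fact (a i)) * (\<Prod>i\<in>I. falling (a i) (b i))
        * (\<Prod>i\<in>I. x i ^ a i))" (is "_ = sum ?G _")
proof -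
  let ?L = "\<lambda>c. restrict (\<lambda>i. c i + b i) I"
  have term_eq: "(\<Prod>i\<in>I. x i ^ b i) * (fact k / (\<Prod>i\<in>I. fact (c i)) * (\<Prod>i\<in>I. x i ^ c i))
      = ?G (?L c)" for c
  proof -
    have "1 / (\<Prod>i\<in>I. fact (c i)) = (\<Prod>i\<in>I. falling (c i + b i) (b i) / fact (c i + b i))"
      by (simp add: falling_add prod_dividef)
    also have "\<dots> = (\<Prod>i\<in>I. falling (c i + b i) (b i)) / (\<Prod>i\<in>I. fact (c i + b i))"
      by (simp add: prod_dividef)
    finally have "fact k / (\<Prod>i\<in>I. fact (c i))
        = fact k / (\<Prod>i\<in>I. fact (c i + b i)) * (\<Prod>i\<in>I. falling (c i + b i) (b i))"
      by (metis (no_types, lifting) mult.right_neutral times_divide_eq_left times_divide_eq_right)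
    then show ?thesis
      by (simp add: power_add prod.distrib mult_ac)
  qed
  have "(\<Prod>i\<in>I. x i ^ b i) * (\<Sum>i\<in>I. x i) ^ k = (\<Sum>c\<in>exponents I k. ?G (?L c))"
    unfolding multinomial[OF assms(1)] sum_distrib_left term_eq ..
  also have "\<dots> = sum ?G {a \<in> exponents I (k + e). \<forall>i\<in>I. b i \<le> a i}"
    by (rule sum.reindex_bij_witness[where i = "\<lambda>a. restrict (\<lambda>i. a i - b i) I" and j = ?L])
      (use assms in \<open>auto simp: exponents_def PiE_iff extensional_def fun_eq_iff sum.distrib sum_subtractf_nat\<close>)
  also have "\<dots> = sum ?G (exponents I (k + e))"
  proof (rule sum.mono_neutral_left)
    show "\<forall>a\<in>exponents I (k + e) - {a \<in> exponents I (k + e). \<forall>i\<in>I. b i \<le> a i}. ?G a = 0"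
    proof
      fix a assume "a \<in> exponents I (k + e) - {a \<in> exponents I (k + e). \<forall>i\<in>I. b i \<le> a i}"
      then obtain i where "i \<in> I" "a i < b i" by (auto simp: not_le)
      then have "(\<Prod>i\<in>I. falling (a i) (b i)) = 0"
        using assms(1) falling_eq_0 by (intro prod_zero) auto
      then show "?G a = 0" by simp
    qed
  qed (use assms finite_exponents in auto)
  finally show ?thesis .
qed

text \<open>
  Both sides are products of \<open>e\<close> factors of absolute value at most \<open>1\<close>, namely \<open>(a\<^sub>i - j)/n\<close> and
  \<open>a\<^sub>i/n\<close> for \<open>j < b\<^sub>i\<close>, and corresponding factors differ by \<open>j/n \<le> e/n\<close>.
\<close>

lemma falling_prod_approx:
  assumes "finite I" "sum b I = e" "a \<in> exponents I n" "e \<le> n" "n > 0"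
  shows "\<bar>(\<Prod>i\<in>I. falling (a i) (b i)) / real n ^ e - (\<Prod>i\<in>I. (a i / n) ^ b i)\<bar> \<le> (real e)\<^sup>2 / n"
proof -
  let ?S = "Sigma I (\<lambda>i. {..<b i})"
  have bi: "b i \<le> e" if "i \<in> I" for i
    using that assms(1,2) member_le_sum[of i I b] by auto
  have ai: "a i \<le> n" if "i \<in> I" for i
    using that assms(1,3) member_le_sum[of i I a] by (auto simp: exponents_def)
  have cS: "card ?S = e"
    using assms by simp
  have "(\<Prod>i\<in>I. falling (a i) (b i)) / real n ^ e = (\<Prod>i\<in>I. falling (a i) (b i) / real n ^ b i)"
    by (simp add: assms(2)[symmetric] prod_dividef power_sum)
  also have "\<dots> = (\<Prod>i\<in>I. \<Prod>j<b i. (real (a i) - real j) / n)"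
    by (simp add: falling_def prod_dividef)
  also have "\<dots> = (\<Prod>(i, j)\<in>?S. (real (a i) - real j) / n)"
    using assms(1) by (intro prod.Sigma) auto
  finally have 1: "(\<Prod>i\<in>I. falling (a i) (b i)) / real n ^ e = (\<Prod>s\<in>?S. (real (a (fst s)) - real (snd s)) / n)"
    by (simp add: case_prod_beta)
  have "(\<Prod>i\<in>I. (a i / n) ^ b i) = (\<Prod>i\<in>I. \<Prod>j<b i. a i / n)"
    by simp
  also have "\<dots> = (\<Prod>(i, j)\<in>?S. a i / n)"
    using assms(1) by (intro prod.Sigma) auto
  finally have 2: "(\<Prod>i\<in>I. (a i / n) ^ b i) = (\<Prod>s\<in>?S. a (fst s) / n)"
    by (simp add: case_prod_beta)
  have "norm ((\<Prod>s\<in>?S. (real (a (fst s)) - real (snd s)) / n) - (\<Prod>s\<in>?S. a (fst s) / n))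
      \<le> (\<Sum>s\<in>?S. norm ((real (a (fst s)) - real (snd s)) / n - a (fst s) / n))"
  proof (rule norm_prod_diff)
    fix s assume s: "s \<in> ?S"
    show "norm (a (fst s) / n) \<le> 1"
      using s ai assms(5) by (auto simp: divide_le_eq)
    have "real (snd s) \<le> n" "real (a (fst s)) \<le> n"
      using s ai bi[of "fst s"] assms(4) by auto
    then show "norm ((real (a (fst s)) - real (snd s)) / n) \<le> 1"
      using assms(5) by (simp add: abs_le_iff divide_le_eq)
  qed
  also have "\<dots> \<le> (\<Sum>s\<in>?S. real e / n)"
  proof (rule sum_mono)
    fix s assume s: "s \<in> ?S"
    then have "snd s \<le> e"
      using bi[of "fst s"] by auto
    then show "norm ((real (a (fst s)) - real (snd s)) / n - a (fst s) / n) \<le> real e / n"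
      using assms(5) by (simp add: diff_divide_distrib divide_right_mono)
  qed
  also have "\<dots> = (real e)\<^sup>2 / n"
    by (simp add: cS power2_eq_square)
  finally show ?thesis
    unfolding 1 2 by simp
qed

text \<open>
  The analytic half of Polya's theorem. Up to the factor \<open>(k + e)\<^sup>e\<close>, the sum at \<open>a\<close> is the value
  at the point \<open>a/(k + e)\<close> of the simplex of a function that converges uniformly to the given form
  as \<open>k\<close> grows. The form is bounded below by \<open>m\<close> on the simplex.
\<close>

lemma polya_coefficients_nonneg:
  fixes c :: "'t \<Rightarrow> real"
  assumes "finite I" "finite T" "\<And>t. t \<in> T \<Longrightarrow> sum (b t) I = e" "m > 0"
    and pos: "\<And>x. (\<forall>i\<in>I. x i \<ge> 0) \<Longrightarrow> sum x I = 1 \<Longrightarrow> (\<Sum>t\<in>T. c t * (\<Prod>i\<in>I. x i ^ b t i)) \<ge> m"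
  shows "\<exists>k. \<forall>a\<in>exponents I (k + e). (\<Sum>t\<in>T. c t * (\<Prod>i\<in>I. falling (a i) (b t i))) \<ge> 0"
proof -
  \<comment> \<open>\<open>C / n\<close> bounds the error at a point with denominator \<open>n\<close>, so \<open>k\<close> is chosen to make it at most \<open>m\<close>\<close>
  define C where "C = (\<Sum>t\<in>T. \<bar>c t\<bar>) * (real e)\<^sup>2"
  obtain k where k: "C / m < real k"
    using reals_Archimedean2 by blast
  have "C \<ge> 0" by (simp add: C_def sum_nonneg)
  then have "real k > 0" using k assms(4) by (smt (verit) divide_nonneg_pos)
  let ?n = "k + e"
  have n: "?n > 0" "C / ?n \<le> m"
  proof -
    show "?n > 0" using \<open>real k > 0\<close> by simp
    have "C \<le> m * k" using k assms(4) by (simp add: divide_less_eq mult.commute)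
    also have "\<dots> \<le> m * ?n" using assms(4) by simp
    finally show "C / ?n \<le> m" using \<open>?n > 0\<close> by (simp add: divide_le_eq del: of_nat_add)
  qed
  have "(\<Sum>t\<in>T. c t * (\<Prod>i\<in>I. falling (a i) (b t i))) \<ge> 0" if a: "a \<in> exponents I ?n" for a
  proof -
    let ?P = "\<lambda>t. (\<Prod>i\<in>I. falling (a i) (b t i)) / real ?n ^ e" and ?Q = "\<lambda>t. \<Prod>i\<in>I. (a i / ?n) ^ b t i"
    have "(\<Sum>t\<in>T. c t * ?Q t) \<ge> m"
    proof (rule pos)
      have "(\<Sum>i\<in>I. real (a i)) = ?n"
        using a unfolding exponents_def by (metis (mono_tags, lifting) mem_Collect_eq of_nat_sum)
      then show "(\<Sum>i\<in>I. a i / ?n) = 1"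
        using n(1) by (simp add: sum_divide_distrib[symmetric] del: of_nat_add)
    qed simp
    moreover have "(\<Sum>t\<in>T. c t * ?Q t) - (\<Sum>t\<in>T. c t * ?P t) \<le> C / ?n"
    proof -
      have "(\<Sum>t\<in>T. c t * ?Q t) - (\<Sum>t\<in>T. c t * ?P t) = (\<Sum>t\<in>T. c t * (?Q t - ?P t))"
        by (simp add: sum_subtractf right_diff_distrib)
      also have "\<dots> \<le> (\<Sum>t\<in>T. \<bar>c t\<bar> * ((real e)\<^sup>2 / ?n))"
      proof (rule sum_mono)
        fix t assume "t \<in> T"
        then have "\<bar>?P t - ?Q t\<bar> \<le> (real e)\<^sup>2 / ?n"
          using falling_prod_approx[OF assms(1) assms(3) a] n(1) by simp
        then have "\<bar>c t\<bar> * \<bar>?Q t - ?P t\<bar> \<le> \<bar>c t\<bar> * ((real e)\<^sup>2 / ?n)"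
          by (intro mult_left_mono) (simp_all add: abs_minus_commute)
        then show "c t * (?Q t - ?P t) \<le> \<bar>c t\<bar> * ((real e)\<^sup>2 / ?n)"
          by (simp add: abs_mult[symmetric])
      qed
      also have "\<dots> = C / ?n"
        by (simp add: C_def sum_distrib_right sum_divide_distrib)
      finally show ?thesis .
    qed
    ultimately have "(\<Sum>t\<in>T. c t * ?P t) \<ge> 0" using n(2) by linarith
    moreover have "(\<Sum>t\<in>T. c t * (\<Prod>i\<in>I. falling (a i) (b t i))) = real ?n ^ e * (\<Sum>t\<in>T. c t * ?P t)"
      unfolding sum_distrib_left using n(1) by (intro sum.cong) (auto simp del: of_nat_add)
    ultimately show ?thesis by simp
  qed
  then show ?thesis by blast
qed

text \<open>
  Polya's theorem for \<open>h\<close> as a form of degree \<open>e\<close> in the squares of the variables: a point \<open>x\<close> of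
  the simplex corresponds to the point with coordinates \<open>sqrt (x i)\<close> of the unit sphere, where
  \<open>h\<close> is bounded below. The product with a power of the squared norm then has nonnegative
  coefficients at squares of monomials.
\<close>

lemma even_pos_def_times_sqnorm_power_sos:
  assumes h: "h \<in> forms N (2 * e)" "pos_def N h" and "N \<ge> 1"
    and even: "\<And>t i. t \<in> keys h \<Longrightarrow> even (lookup t i)"
  obtains k where "h * sqnorm N ^ k \<in> sos N"
proof -
  let ?I = "{1..N}"
  define b where "b t i = lookup t i div 2" for t :: monom and i
  have keys: "keys t \<subseteq> ?I" "mdeg t = 2 * e" if "t \<in> keys h" for t
    using h(1) that by (auto simp: forms_def polys_def)
  have eval_h: "eval_poly z h = (\<Sum>t\<in>keys h. lookup h t * (\<Prod>i\<in>?I. ((z i)\<^sup>2) ^ b t i))" for z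
    unfolding eval_poly_mon_val
  proof (rule sum.cong[OF refl])
    fix t assume t: "t \<in> keys h"
    have "mon_val z t = (\<Prod>i\<in>?I. z i ^ lookup t i)"
      by (rule mon_val_superset) (use keys[OF t] in auto)
    also have "\<dots> = (\<Prod>i\<in>?I. ((z i)\<^sup>2) ^ b t i)"
      using even[OF t] by (simp add: b_def flip: power_mult)
    finally show "lookup h t * mon_val z t = lookup h t * (\<Prod>i\<in>?I. ((z i)\<^sup>2) ^ b t i)"
      by simp
  qed
  have sum_b: "sum (b t) ?I = e" if t: "t \<in> keys h" for t
  proof -
    have "2 * sum (b t) ?I = (\<Sum>i\<in>?I. lookup t i)"
      using even[OF t] by (simp add: b_def sum_distrib_left)
    also have "\<dots> = 2 * e"
      using mdeg_superset[of ?I t] keys[OF t] by simp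
    finally show ?thesis by simp
  qed
  obtain m where m: "m > 0" "\<And>z. (\<Sum>i=1..N. (z i)\<^sup>2) = 1 \<Longrightarrow> eval_poly z h \<ge> m"
    using pos_def_bounded_below[OF forms_polys[OF h(1)] h(2) \<open>N \<ge> 1\<close>] by blast
  have lower: "(\<Sum>t\<in>keys h. lookup h t * (\<Prod>i\<in>?I. x i ^ b t i)) \<ge> m"
    if x: "\<forall>i\<in>?I. x i \<ge> 0" "sum x ?I = 1" for x :: "nat \<Rightarrow> real"
  proof -
    have "(\<Sum>i\<in>?I. (sqrt (x i))\<^sup>2) = 1"
      using x by simp
    then have "m \<le> eval_poly (\<lambda>i. sqrt (x i)) h"
      by (rule m(2))
    also have "\<dots> = (\<Sum>t\<in>keys h. lookup h t * (\<Prod>i\<in>?I. x i ^ b t i))"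
      unfolding eval_h using x(1) by (intro sum.cong arg_cong2[of _ _ _ _ "(*)"] prod.cong) auto
    finally show ?thesis .
  qed
  have "\<exists>k. \<forall>a\<in>exponents ?I (k + e).
      (\<Sum>t\<in>keys h. lookup h t * (\<Prod>i\<in>?I. falling (a i) (b t i))) \<ge> 0"
    by (rule polya_coefficients_nonneg[OF finite_atLeastAtMost finite_keys sum_b m(1)])
      (assumption, rule lower)
  then obtain k where k: "\<And>a. a \<in> exponents ?I (k + e) \<Longrightarrow>
      (\<Sum>t\<in>keys h. lookup h t * (\<Prod>i\<in>?I. falling (a i) (b t i))) \<ge> 0"
    by blast
  define c where "c a = fact k / (\<Prod>i\<in>?I. fact (a i))
      * (\<Sum>t\<in>keys h. lookup h t * (\<Prod>i\<in>?I. falling (a i) (b t i)))" for a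
  have "h * sqnorm N ^ k = (\<Sum>a\<in>exponents ?I (k + e). Cst (c a) * (\<Prod>i\<in>?I. Var i ^ a i)\<^sup>2)"
  proof (rule eval_inject)
    fix z :: "nat \<Rightarrow> real"
    let ?x = "\<lambda>i. (z i)\<^sup>2"
    have "eval_poly z (h * sqnorm N ^ k)
        = (\<Sum>t\<in>keys h. lookup h t * ((\<Prod>i\<in>?I. ?x i ^ b t i) * (\<Sum>i\<in>?I. ?x i) ^ k))"
      unfolding eval_mult eval_power eval_h eval_sqnorm sum_distrib_right mult.assoc ..
    also have "\<dots> = (\<Sum>t\<in>keys h. \<Sum>a\<in>exponents ?I (k + e). lookup h t * (fact k / (\<Prod>i\<in>?I. fact (a i))
        * (\<Prod>i\<in>?I. falling (a i) (b t i)) * (\<Prod>i\<in>?I. ?x i ^ a i)))"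
      unfolding sum_distrib_left[symmetric]
      by (intro sum.cong refl arg_cong2[of _ _ _ _ "(*)"] monomial_times_sum_power)
        (simp_all only: finite_atLeastAtMost sum_b)
    also have "\<dots> = (\<Sum>a\<in>exponents ?I (k + e). c a * (\<Prod>i\<in>?I. ?x i ^ a i))"
      by (subst sum.swap) (simp add: c_def sum_distrib_left sum_distrib_right mult_ac)
    also have "\<dots> = eval_poly z (\<Sum>a\<in>exponents ?I (k + e). Cst (c a) * (\<Prod>i\<in>?I. Var i ^ a i)\<^sup>2)"
      by (simp add: eval_ring prod_power_distrib mult.commute flip: power_mult)
    finally show "eval_poly z (h * sqnorm N ^ k)
        = eval_poly z (\<Sum>a\<in>exponents ?I (k + e). Cst (c a) * (\<Prod>i\<in>?I. Var i ^ a i)\<^sup>2)" .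
  qed
  moreover have "Cst (c a) * (\<Prod>i\<in>?I. Var i ^ a i)\<^sup>2 \<in> sos N" if "a \<in> exponents ?I (k + e)" for a
  proof (intro sos_mult sos_Cst sos_square polys_prod polys_power polys_Var)
    show "c a \<ge> 0"
      unfolding c_def using k[OF that] by (intro mult_nonneg_nonneg divide_nonneg_nonneg prod_nonneg) auto
  qed
  ultimately have "h * sqnorm N ^ k \<in> sos N"
    using sos_sum[of "exponents ?I (k + e)"] by (metis (no_types, lifting))
  then show ?thesis using that by blast
qed

section \<open>Habicht's theorem\<close>

definition monomials_where :: "(monom \<Rightarrow> bool) \<Rightarrow> rpoly \<Rightarrow> rpoly" where
  "monomials_where P q = (\<Sum>t\<in>{t \<in> keys q. P t}. single t (lookup q t))"

lemma lookup_monomials_where: "lookup (monomials_where P q) s = (if P s then lookup q s else 0)"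
proof -
  have "lookup (monomials_where P q) s = (\<Sum>t\<in>{t \<in> keys q. P t}. if t = s then lookup q s else 0)"
    unfolding monomials_where_def lookup_sum by (rule sum.cong) (auto simp: lookup_single)
  then show ?thesis
    by (simp add: in_keys_iff)
qed

lemma keys_monomials_where: "keys (monomials_where P q) \<subseteq> {t \<in> keys q. P t}"
  by (auto simp: in_keys_iff lookup_monomials_where split: if_splits)

lemma monomials_where_add_monomials_where: "monomials_where P q + monomials_where (\<lambda>t. \<not> P t) q = q"
  by (rule poly_mapping_eqI) (simp add: lookup_add lookup_monomials_where)

lemma monomials_where_forms: "q \<in> forms N k \<Longrightarrow> monomials_where P q \<in> forms N k"
  using keys_monomials_where[of P q] unfolding forms_def polys_def by blast

lemma mon_val_flip: "mon_val (x(i := - x i)) t = (- 1) ^ lookup t i * mon_val x t"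
proof -
  have "mon_val y t = y i ^ lookup t i * (\<Prod>j\<in>keys t - {i}. y j ^ lookup t j)" for y
    by (subst mon_val_superset[of "insert i (keys t)"]) (auto simp: prod.insert_remove)
  moreover have "(\<Prod>j\<in>keys t - {i}. (x(i := - x i)) j ^ lookup t j) = (\<Prod>j\<in>keys t - {i}. x j ^ lookup t j)"
    by (intro prod.cong) auto
  ultimately show ?thesis
    by (simp add: power_minus[of "x i"])
qed

lemma eval_flip_even:
  "(\<And>t. t \<in> keys q \<Longrightarrow> even (lookup t i)) \<Longrightarrow> eval_poly (x(i := - x i)) q = eval_poly x q"
  unfolding eval_poly_mon_val mon_val_flip by (intro sum.cong) auto

lemma eval_flip_odd:
  "(\<And>t. t \<in> keys q \<Longrightarrow> odd (lookup t i)) \<Longrightarrow> eval_poly (x(i := - x i)) q = - eval_poly x q"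
  unfolding eval_poly_mon_val mon_val_flip sum_negf[symmetric] by (intro sum.cong) auto

text \<open>
  Induction on the number \<open>j\<close> of variables in which \<open>h\<close> need not be even. The even part \<open>A\<close> of \<open>h\<close>
  in the variable \<open>j + 1\<close> and the product \<open>C\<close> of \<open>h\<close> with its reflection satisfy the induction
  hypothesis, and \<open>2 A h = h\<^sup>2 + C\<close> turns multipliers for \<open>A\<close> and \<open>C\<close> into one for \<open>h\<close>.
\<close>

lemma pos_def_even_after_times_sos:
  assumes "N \<ge> 1" "h \<in> forms N (2 * e)" "pos_def N h"
    and "\<And>t i. t \<in> keys h \<Longrightarrow> i > j \<Longrightarrow> even (lookup t i)"
  shows "\<exists>r. \<exists>q\<in>forms N (2 * r). q \<noteq> 0 \<and> q \<in> sos N \<and> h * q \<in> sos N"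
  using assms(2-)
proof (induction j arbitrary: h e)
  case 0
  \<comment> \<open>no monomial of \<open>h\<close> involves the index \<open>0\<close>, which the hypothesis does not cover\<close>
  have ev: "even (lookup t i)" if "t \<in> keys h" for t i
  proof (cases "i = 0")
    case True
    then have "i \<notin> keys t"
      using 0(1) that by (fastforce simp: forms_def polys_def)
    then show ?thesis by (simp add: in_keys_iff)
  next
    case False
    then show ?thesis using 0(3) that by simp
  qed
  obtain k where k: "h * sqnorm N ^ k \<in> sos N"
    using even_pos_def_times_sqnorm_power_sos[OF 0(1,2) assms(1)] ev by blast
  show ?case
    using k sqnorm_nonzero[OF assms(1)] sqnorm_power_forms[of N k] sos_power[OF sqnorm_sos, of N k]
    by (intro exI[of _ k] bexI[of _ "sqnorm N ^ k"]) auto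
next
  case (Suc j)
  let ?i = "Suc j"
  define A where "A = monomials_where (\<lambda>t. even (lookup t ?i)) h"
  define B where "B = monomials_where (\<lambda>t. odd (lookup t ?i)) h"
  define C where "C = A * A - B * B"
  have h: "h = A + B"
    unfolding A_def B_def using monomials_where_add_monomials_where by simp
  have A_keys: "t \<in> keys h" "even (lookup t ?i)" if "t \<in> keys A" for t
    using that keys_monomials_where[of _ h] by (auto simp: A_def)
  have B_keys: "t \<in> keys h" "odd (lookup t ?i)" if "t \<in> keys B" for t
    using that keys_monomials_where[of _ h] by (auto simp: B_def)
  have A_form: "A \<in> forms N (2 * e)" and B_form: "B \<in> forms N (2 * e)"
    using Suc.prems(1) by (simp_all add: A_def B_def monomials_where_forms)
  have C_form: "C \<in> forms N (2 * (2 * e))"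
    unfolding C_def using forms_diff[OF forms_mult[OF A_form A_form] forms_mult[OF B_form B_form]]
    by (simp add: mult_2)
  have A_even: "even (lookup t i)" if "t \<in> keys A" "i > j" for t i
    using that A_keys[of t] Suc.prems(3)[of t i] by (cases "i = ?i") auto
  have C_even: "even (lookup t i)" if t: "t \<in> keys C" and i: "i > j" for t i
  proof -
    consider a b where "a \<in> keys A" "b \<in> keys A" "t = a + b"
      | a b where "a \<in> keys B" "b \<in> keys B" "t = a + b"
      using t keys_minus[of "A * A" "B * B"] unfolding C_def by (blast elim: keys_multE)
    then show ?thesis
    proof cases
      case 1
      then show ?thesis using A_even i by (simp add: lookup_add)
    next
      case 2
      then show ?thesis
        using B_keys[of a] B_keys[of b] Suc.prems(3)[of a i] Suc.prems(3)[of b i] i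
        by (cases "i = ?i") (auto simp: lookup_add)
    qed
  qed
  have flip: "eval_poly (x(?i := - x ?i)) h = eval_poly x A - eval_poly x B" for x
    unfolding h eval_add using A_keys(2) B_keys(2) by (simp add: eval_flip_even eval_flip_odd)
  have both: "eval_poly x A + eval_poly x B > 0 \<and> eval_poly x A - eval_poly x B > 0"
    if "\<exists>i\<in>{1..N}. x i \<noteq> 0" for x :: "nat \<Rightarrow> real"
  proof -
    from that obtain i where i: "i \<in> {1..N}" "x i \<noteq> 0" by blast
    have "eval_poly x h > 0" "eval_poly (x(?i := - x ?i)) h > 0"
      using i by (auto intro!: pos_defD[OF Suc.prems(2), of i] split: if_splits)
    then show ?thesis unfolding flip by (simp add: h eval_add)
  qed
  have A_pos: "pos_def N A"
    unfolding pos_def_def using both by fastforce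
  have C_pos: "pos_def N C"
    unfolding pos_def_def
  proof (intro allI impI)
    fix x :: "nat \<Rightarrow> real" assume "\<exists>i\<in>{1..N}. x i \<noteq> 0"
    then have "(eval_poly x A + eval_poly x B) * (eval_poly x A - eval_poly x B) > 0"
      using both by simp
    then show "eval_poly x C > 0"
      by (simp add: C_def eval_ring algebra_simps)
  qed
  obtain r1 q1 where q1: "q1 \<in> forms N (2 * r1)" "q1 \<noteq> 0" "q1 \<in> sos N" "A * q1 \<in> sos N"
    using Suc.IH[OF A_form A_pos A_even] by blast
  obtain r2 q2 where q2: "q2 \<in> forms N (2 * r2)" "q2 \<noteq> 0" "q2 \<in> sos N" "C * q2 \<in> sos N"
    using Suc.IH[OF C_form C_pos C_even] by blast
  let ?q = "Cst 2 * ((A * q1) * q2)"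
  have "A \<noteq> 0"
    using pos_defD[OF A_pos, of 1 "\<lambda>_. 1"] assms(1) by auto
  have two: "Cst 2 = 2"
    by (simp add: Cst_def)
  have "?q \<in> forms N (2 * (e + r1 + r2))"
    using forms_Cst_mult[OF forms_mult[OF forms_mult[OF A_form q1(1)] q2(1)]]
    by (simp add: algebra_simps)
  moreover have "?q \<noteq> 0"
    using \<open>A \<noteq> 0\<close> q1(2) q2(2) by (simp add: two)
  moreover have "?q \<in> sos N"
    using sos_mult[OF sos_Cst sos_mult[OF q1(4) q2(3)], of 2] by simp
  moreover have "h * ?q = h\<^sup>2 * (q1 * q2) + q1 * (C * q2)"
    unfolding two h C_def by (simp add: power2_eq_square algebra_simps)
  then have "h * ?q \<in> sos N"
    using q1 q2 sos_square[OF forms_polys[OF Suc.prems(1)]] by (simp add: sos_add sos_mult)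
  ultimately show ?case by blast
qed

lemma pos_def_in_A_set:
  assumes "N \<ge> 1" "h \<in> forms N (2 * e)" "pos_def N h"
  obtains r where "h \<in> A_set N (2 * e) r"
proof -
  have "even (lookup t i)" if "t \<in> keys h" "i > N" for t i
  proof -
    have "i \<notin> keys t"
      using assms(2) that by (fastforce simp: forms_def polys_def)
    then show ?thesis by (simp add: in_keys_iff)
  qed
  then show ?thesis
    using pos_def_even_after_times_sos[OF assms, of N] that assms(2) unfolding A_set_def by blast
qed

section \<open>The hierarchy of inner approximations\<close>

text \<open>
  If \<open>q\<close> is a multiplier for \<open>h\<close>, then \<open>q\<close> times a power of the squared norm, chosen to reach the
  larger degree, is one for the sum: both products that arise are sums of squares.
\<close>

lemma A_set_add_sqnorm_power:
  assumes "h \<in> A_set N (2 * D) r" "c \<ge> 0" "r \<le> r'" "N \<ge> 1"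
  shows "h + Cst c * sqnorm N ^ D \<in> A_set N (2 * D) r'"
proof -
  obtain q where h: "h \<in> forms N (2 * D)"
    and q: "q \<in> forms N (2 * r)" "q \<noteq> 0" "q \<in> sos N" "h * q \<in> sos N"
    using assms(1) unfolding A_set_def by blast
  let ?s = "sqnorm N ^ (r' - r)"
  have "q * ?s \<in> forms N (2 * r')"
    using forms_mult[OF q(1) sqnorm_power_forms[of N "r' - r"]] assms(3) by (simp add: algebra_simps)
  moreover have "q * ?s \<noteq> 0"
    using q(2) sqnorm_nonzero[OF assms(4)] by simp
  moreover have "q * ?s \<in> sos N"
    by (intro sos_mult q sos_power sqnorm_sos)
  moreover have "(h + Cst c * sqnorm N ^ D) * (q * ?s) \<in> sos N"
  proof -
    have "(h + Cst c * sqnorm N ^ D) * (q * ?s)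
        = (h * q) * ?s + Cst c * sqnorm N ^ D * (q * ?s)"
      by (simp add: algebra_simps)
    moreover have "\<dots> \<in> sos N"
      by (intro sos_add sos_mult q sos_power sqnorm_sos sos_Cst assms)
    ultimately show ?thesis by simp
  qed
  moreover have "h + Cst c * sqnorm N ^ D \<in> forms N (2 * D)"
    by (intro forms_add h forms_Cst_mult sqnorm_power_forms)
  ultimately show ?thesis
    unfolding A_set_def by blast
qed

lemma minus_sqnorm_power_shift:
  "h - Cst a * sqnorm N ^ D + Cst (a - b) * sqnorm N ^ D = h - Cst b * sqnorm N ^ D"
  by (simp add: Cst_diff[symmetric] algebra_simps)

lemma A_set_mono:
  assumes "h - Cst (1 / real r) * sqnorm N ^ D \<in> A_set N (2 * D) s"
    and "1 \<le> r" "r \<le> r'" "s \<le> s'" "N \<ge> 1"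
  shows "h - Cst (1 / real r') * sqnorm N ^ D \<in> A_set N (2 * D) s'"
proof -
  have "1 / real r - 1 / real r' \<ge> 0"
    using assms(2,3) by (simp add: frac_le)
  then show ?thesis
    using A_set_add_sqnorm_power[OF assms(1) _ assms(4,5)] minus_sqnorm_power_shift by metis
qed

lemma A_set_nonneg:
  assumes "h \<in> A_set N k r"
  shows "eval_poly x h \<ge> 0"
  using assms nonneg_of_mult_nonneg sos_nonneg unfolding A_set_def by blast

lemma pos_def_of_A_set:
  assumes "h - Cst (1 / real r) * sqnorm N ^ D \<in> A_set N k s" "r \<ge> 1"
  shows "pos_def N h"
  unfolding pos_def_def
proof (intro allI impI)
  fix x :: "nat \<Rightarrow> real" assume "\<exists>i\<in>{1..N}. x i \<noteq> 0"
  then have "1 / real r * eval_poly x (sqnorm N) ^ D > 0"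
    using sqnorm_pos assms(2) by simp
  then show "eval_poly x h > 0"
    using A_set_nonneg[OF assms(1), of x] by (simp add: eval_ring)
qed

text \<open>
  A lower bound of \<open>h\<close> on the unit sphere becomes, by homogeneity, a lower bound by a multiple of
  a power of the norm; any \<open>r\<close> such that \<open>1/r\<close> is less than the bound will do.
\<close>

lemma pos_def_minus_sqnorm_power:
  assumes "N \<ge> 1" "h \<in> forms N (2 * D)" "pos_def N h"
  obtains r where "r \<ge> 1" "pos_def N (h - Cst (1 / real r) * sqnorm N ^ D)"
proof -
  obtain m where m: "m > 0" "\<And>x. (\<Sum>i=1..N. (x i)\<^sup>2) = 1 \<Longrightarrow> eval_poly x h \<ge> m"
    using pos_def_bounded_below[OF forms_polys[OF assms(2)] assms(3,1)] by blast
  obtain r where r: "r > 0" "1 / real r < m"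
    using reals_Archimedean[OF m(1)] by (metis inverse_eq_divide zero_less_Suc)
  have "eval_poly x (h - Cst (1 / real r) * sqnorm N ^ D) > 0"
    if x: "\<exists>i\<in>{1..N}. x i \<noteq> 0" for x :: "nat \<Rightarrow> real"
  proof -
    define s where "s = eval_poly x (sqnorm N)"
    have s: "s > 0" unfolding s_def using sqnorm_pos[OF x] .
    have "(\<Sum>i=1..N. (1 / sqrt s * x i)\<^sup>2) = eval_poly x (sqnorm N) / s"
      using s by (simp add: eval_sqnorm power_mult_distrib power_divide sum_divide_distrib)
    then have "m \<le> eval_poly (\<lambda>i. 1 / sqrt s * x i) h"
      using m(2) s by (simp add: s_def)
    also have "\<dots> = eval_poly x h / s ^ D"
      unfolding eval_form_scale[OF assms(2)] using s by (simp add: power_mult power_divide)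
    finally have "m * s ^ D \<le> eval_poly x h"
      using s by (simp add: le_divide_eq)
    moreover have "1 / real r * s ^ D < m * s ^ D"
      using r s by (intro mult_strict_right_mono) auto
    ultimately show ?thesis
      by (simp add: eval_ring s_def)
  qed
  then show ?thesis
    using that[of r] r(1) unfolding pos_def_def by simp
qed

text \<open>
  One \<open>r\<^sub>1\<close> keeps the form positive definite, and the resulting form has a multiplier of some degree
  \<open>2 s\<close>. Since both parameters may be increased independently, every \<open>r \<ge> max r\<^sub>1 s\<close> serves as both.
\<close>

lemma pos_def_eventually_in_A_set:
  assumes "N \<ge> 1" "h \<in> forms N (2 * D)" "pos_def N h"
  obtains r0 where "\<And>r. r \<ge> r0 \<Longrightarrow> h - Cst (1 / real r) * sqnorm N ^ D \<in> A_set N (2 * D) r"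
proof -
  obtain r1 where r1: "r1 \<ge> 1" "pos_def N (h - Cst (1 / real r1) * sqnorm N ^ D)"
    using pos_def_minus_sqnorm_power[OF assms] by blast
  have "h - Cst (1 / real r1) * sqnorm N ^ D \<in> forms N (2 * D)"
    by (intro forms_diff assms forms_Cst_mult sqnorm_power_forms)
  then obtain s where "h - Cst (1 / real r1) * sqnorm N ^ D \<in> A_set N (2 * D) s"
    using pos_def_in_A_set[OF assms(1) _ r1(2)] by blast
  then have "h - Cst (1 / real r) * sqnorm N ^ D \<in> A_set N (2 * D) r" if "r \<ge> max r1 s" for r
    using A_set_mono r1(1) that assms(1) by auto
  then show ?thesis using that by blast
qed

section \<open>The form attached to the optimization problem\<close>

lemma total_deg_mdeg:
  assumes "total_deg q \<le> k" "t \<in> keys q"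
  shows "mdeg t \<le> k"
proof -
  have "mdeg t \<le> total_deg q"
    unfolding total_deg_def using assms(2) by (intro Max_ge) auto
  then show ?thesis using assms(1) by simp
qed

lemma eval_homogenize:
  assumes "total_deg q \<le> k" "x v \<noteq> 0"
  shows "eval_poly x (homogenize v k q) = x v ^ k * eval_poly (\<lambda>i. x i / x v) q"
proof -
  have "mon_val x t * x v ^ (k - mdeg t) = x v ^ k * mon_val (\<lambda>i. x i / x v) t"
    if "t \<in> keys q" for t
  proof -
    have "mon_val (\<lambda>i. x i / x v) t = mon_val x t / x v ^ mdeg t"
      by (simp add: mon_val_def mdeg_def power_divide prod_dividef power_sum)
    moreover have "x v ^ k = x v ^ (k - mdeg t) * x v ^ mdeg t"
      using total_deg_mdeg[OF assms(1) that] by (simp flip: power_add)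
    ultimately show ?thesis using assms(2) by simp
  qed
  then show ?thesis
    by (simp add: homogenize_def eval_sum eval_single mon_val_add mon_val_single
        eval_poly_mon_val[of "\<lambda>i. x i / x v"] sum_distrib_left mult_ac)
qed

lemma homogenize_forms:
  assumes "total_deg q \<le> k" "q \<in> polys n" "n \<le> N" "v \<in> {1..N}"
  shows "homogenize v k q \<in> forms N k"
  unfolding homogenize_def
proof (rule forms_sum)
  fix t assume t: "t \<in> keys q"
  have "mdeg (t + single v (k - mdeg t)) = k"
    using total_deg_mdeg[OF assms(1) t] by (simp add: mdeg_add) (simp add: mdeg_def)
  moreover have "keys (t + single v (k - mdeg t)) \<subseteq> {1..N}"
  proof -
    have "keys t \<subseteq> {1..N}"
      using t assms(2,3) by (fastforce simp: polys_def)
    then show ?thesis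
      using keys_add[of t "single v (k - mdeg t)"] assms(4) by (auto split: if_splits)
  qed
  ultimately show "single (t + single v (k - mdeg t)) (lookup q t) \<in> forms N k"
    by (simp add: forms_def polys_def)
qed

locale bounded_problem =
  fixes n m d :: nat and p :: rpoly and g :: "nat \<Rightarrow> rpoly"
    and R \<beta> :: real and \<eta> :: "nat \<Rightarrow> real"
  assumes p: "p \<in> polys n" and g: "\<And>i. i \<in> {1..m} \<Longrightarrow> g i \<in> polys n"
    and d: "d \<ge> 1"
    and deg_p: "total_deg p \<le> 2 * d" and deg_g: "\<And>i. i \<in> {1..m} \<Longrightarrow> total_deg (g i) \<le> 2 * d"
    and R: "\<And>x. x \<in> feasible n m g \<Longrightarrow> (\<Sum>i=1..n. (x i)\<^sup>2) \<le> R"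
    and \<eta>: "\<And>x i. x \<in> feasible n m g \<Longrightarrow> i \<in> {1..m} \<Longrightarrow> eval_poly x (g i) \<le> \<eta> i"
    and \<beta>: "\<And>x. x \<in> feasible n m g \<Longrightarrow> - eval_poly x p \<le> \<beta>"
begin

abbreviation N :: nat where "N \<equiv> n + m + 3"

abbreviation f :: "real \<Rightarrow> rpoly" where "f \<equiv> f_form n m d R \<eta> \<beta> p g"

lemma f_forms: "f \<gamma> \<in> forms N (2 * (2 * d))"
proof -
  have var: "Var i \<in> forms N 1" if "1 \<le> i" "i \<le> N" for i
    using that by (intro forms_Var) simp
  have sq: "q\<^sup>2 \<in> forms N (2 * (2 * d))" if "q \<in> forms N (2 * d)" for q
    using forms_power[OF that, of 2] by simp
  have var_power: "Var i ^ k \<in> forms N k" if "1 \<le> i" "i \<le> N" for i k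
    using forms_power[OF var[OF that], of k] by simp
  have slack: "(Var i)\<^sup>2 * Var N ^ (2 * d - 2) \<in> forms N (2 * d)" if "1 \<le> i" "i \<le> N" for i
  proof -
    have "2 + (2 * d - 2) = 2 * d" using d by simp
    then show ?thesis
      using forms_mult[OF var_power[OF that, of 2] var_power[of N "2 * d - 2"]] by simp
  qed
  have hom: "homogenize N (2 * d) q \<in> forms N (2 * d)" if "q \<in> polys n" "total_deg q \<le> 2 * d" for q
    using that by (intro homogenize_forms[of _ _ n]) auto
  have norm: "((\<Sum>i=1..n. (Var i)\<^sup>2) + (\<Sum>i=0..m. (Var (n + 1 + i))\<^sup>2)) ^ d \<in> forms N (2 * d)"
  proof -
    have "(\<Sum>i=1..n. (Var i)\<^sup>2) + (\<Sum>i=0..m. (Var (n + 1 + i))\<^sup>2) \<in> forms N 2"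
      by (intro forms_add forms_sum var_power) auto
    then show ?thesis
      using forms_power[of _ N 2 d] by (simp add: mult.commute)
  qed
  show ?thesis
    unfolding f_form_def Let_def
    by (intro forms_add forms_sum sq forms_diff forms_Cst_mult var_power slack hom norm p g deg_p deg_g)
      auto
qed

lemma eval_f:
  "eval_poly z (f \<gamma>) =
    (\<gamma> * z N ^ (2 * d) - eval_poly z (homogenize N (2 * d) p) - (z (n + 1))\<^sup>2 * z N ^ (2 * d - 2))\<^sup>2
    + (\<Sum>i=1..m. (eval_poly z (homogenize N (2 * d) (g i)) - (z (n + 1 + i))\<^sup>2 * z N ^ (2 * d - 2))\<^sup>2)
    + ((R + (\<Sum>i=1..m. \<eta> i) + \<beta> + \<gamma>) ^ d * z N ^ (2 * d)
        - ((\<Sum>i=1..n. (z i)\<^sup>2) + (\<Sum>i=0..m. (z (n + 1 + i))\<^sup>2)) ^ d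
        - z (n + 1 + (m + 1)) ^ (2 * d))\<^sup>2"
  by (simp add: f_form_def Let_def eval_ring)

lemma restrict_feasible:
  assumes "\<And>i. i \<in> {1..m} \<Longrightarrow> eval_poly u (g i) \<ge> 0"
  shows "restrict u {1..n} \<in> feasible n m g" "eval_poly (restrict u {1..n}) p = eval_poly u p"
  using assms eval_cong[OF p, of "restrict u {1..n}" u] eval_cong[OF g, of _ "restrict u {1..n}" u]
  by (auto simp: feasible_def)

text \<open>
  At a zero all squares vanish. If \<open>y = 0\<close>, the last one says that a sum of even powers of the other
  variables is \<open>0\<close>, so the zero is trivial. If \<open>y \<noteq> 0\<close>, dividing the point by \<open>y\<close> gives a feasible
  point at which \<open>p\<close> is at most \<open>\<gamma>\<close>.
\<close>

lemma f_pos_def: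
  assumes "ereal \<gamma> < opt_val n m p g"
  shows "pos_def N (f \<gamma>)"
proof (rule ccontr)
  assume "\<not> pos_def N (f \<gamma>)"
  then obtain z j where z: "j \<in> {1..N}" "z j \<noteq> 0" "eval_poly z (f \<gamma>) \<le> 0"
    unfolding pos_def_def by (auto simp: not_less)
  define a where "a = \<gamma> * z N ^ (2 * d) - eval_poly z (homogenize N (2 * d) p) - (z (n + 1))\<^sup>2 * z N ^ (2 * d - 2)"
  define b where "b i = eval_poly z (homogenize N (2 * d) (g i)) - (z (n + 1 + i))\<^sup>2 * z N ^ (2 * d - 2)" for i
  define Q where "Q = (\<Sum>i=1..n. (z i)\<^sup>2) + (\<Sum>i=0..m. (z (n + 1 + i))\<^sup>2)"
  define c where "c = (R + (\<Sum>i=1..m. \<eta> i) + \<beta> + \<gamma>) ^ d * z N ^ (2 * d) - Q ^ d - z (n + 1 + (m + 1)) ^ (2 * d)"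
  have "a\<^sup>2 + (\<Sum>i=1..m. (b i)\<^sup>2) + c\<^sup>2 \<le> 0"
    using z(3) unfolding eval_f a_def b_def c_def Q_def .
  moreover have sb: "(\<Sum>i=1..m. (b i)\<^sup>2) \<ge> 0" by (intro sum_nonneg) auto
  ultimately have "a\<^sup>2 = 0" "(\<Sum>i=1..m. (b i)\<^sup>2) = 0" "c\<^sup>2 = 0"
    using zero_le_power2[of a] zero_le_power2[of c] by linarith+
  then have a0: "a = 0" and b0: "\<And>i. i \<in> {1..m} \<Longrightarrow> b i = 0" and c0: "c = 0"
    by (auto simp: sum_nonneg_eq_0_iff)
  show False
  proof (cases "z N = 0")
    case True
    have "Q \<ge> 0" unfolding Q_def by (intro add_nonneg_nonneg sum_nonneg) auto
    then have "Q ^ d \<ge> 0" by simp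
    moreover have "z (n + 1 + (m + 1)) ^ (2 * d) \<ge> 0" by (simp add: power_mult)
    moreover have "- (Q ^ d) - z (n + 1 + (m + 1)) ^ (2 * d) = 0"
      using c0 True d by (simp add: c_def power_0_left)
    ultimately have "Q ^ d = 0" "z (n + 1 + (m + 1)) ^ (2 * d) = 0"
      by linarith+
    then have last: "z (n + 1 + (m + 1)) = 0" and "Q = 0"
      by auto
    then have "(\<Sum>i=1..n. (z i)\<^sup>2) = 0" "(\<Sum>i=0..m. (z (n + 1 + i))\<^sup>2) = 0"
      unfolding Q_def using sum_nonneg[of "{1..n}" "\<lambda>i. (z i)\<^sup>2"]
        sum_nonneg[of "{0..m}" "\<lambda>i. (z (n + 1 + i))\<^sup>2"] by (simp_all add: add_nonneg_eq_0_iff)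
    then have xs: "\<And>i. i \<in> {1..n} \<Longrightarrow> z i = 0" "\<And>i. i \<in> {0..m} \<Longrightarrow> z (n + 1 + i) = 0"
      by (simp_all add: sum_nonneg_eq_0_iff)
    consider "j \<in> {1..n}" | "j - (n + 1) \<in> {0..m}" "j = n + 1 + (j - (n + 1))"
      | "j = n + 1 + (m + 1)" | "j = N"
      using z(1) by fastforce
    then show False
      using xs last True z(2) by cases metis+
  next
    case False
    let ?u = "\<lambda>i. z i / z N"
    have pos: "z N ^ (2 * d) > 0" "z N ^ (2 * d - 2) \<ge> 0"
      using False by (simp_all add: zero_less_power_eq zero_le_power_eq)
    have "z N ^ (2 * d) * eval_poly ?u (g i) \<ge> 0" if "i \<in> {1..m}" for i
      using b0[OF that] eval_homogenize[where q = "g i" and k = "2 * d" and v = N and x = z, OF deg_g[OF that] False] pos(2)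
      by (simp add: b_def)
    then have u: "restrict ?u {1..n} \<in> feasible n m g" "eval_poly (restrict ?u {1..n}) p = eval_poly ?u p"
      using restrict_feasible[of ?u] pos(1) by (auto simp: zero_le_mult_iff)
    have "z N ^ (2 * d) * (\<gamma> - eval_poly ?u p) \<ge> 0"
      using a0 eval_homogenize[where q = p and k = "2 * d" and v = N and x = z, OF deg_p False] pos(2)
      by (simp add: a_def right_diff_distrib mult.commute)
    then have "eval_poly ?u p \<le> \<gamma>"
      using pos(1) by (simp add: zero_le_mult_iff)
    moreover have "opt_val n m p g \<le> ereal (eval_poly ?u p)"
      unfolding opt_val_def using u by (metis INF_lower)
    ultimately show False
      using assms by (meson ereal_less_eq(3) leD order_trans)
  qed
qed

text \<open>
  The feasible point is extended to a zero with \<open>y = 1\<close>: the \<open>s\<^sub>i\<close> are the square roots of the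
  slacks, and \<open>s\<^bsub>m+1\<^esub>\<close> is the root of what is left in the last square, which is nonnegative by the
  choice of the bounds \<open>R\<close>, \<open>\<eta>\<close> and \<open>\<beta>\<close>.
\<close>

lemma f_not_pos_def:
  assumes "x \<in> feasible n m g" "eval_poly x p \<le> \<gamma>"
  shows "\<not> pos_def N (f \<gamma>)"
proof -
  define s where "s i = (if i = 0 then sqrt (\<gamma> - eval_poly x p) else sqrt (eval_poly x (g i)))" for i
  define M where "M = R + (\<Sum>i=1..m. \<eta> i) + \<beta> + \<gamma>"
  define Q where "Q = (\<Sum>i=1..n. (x i)\<^sup>2) + (\<Sum>i=0..m. (s i)\<^sup>2)"
  define w where "w = root (2 * d) (M ^ d - Q ^ d)"
  define z where "z i = (if i \<le> n then x i else if i \<le> n + 1 + m then s (i - (n + 1))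
    else if i = n + 1 + (m + 1) then w else 1)" for i
  have zx: "z i = x i" if "i \<in> {1..n}" for i using that by (simp add: z_def)
  have zs: "z (n + 1 + i) = s i" if "i \<le> m" for i using that by (simp add: z_def)
  have zw: "z (n + 1 + (m + 1)) = w" by (simp add: z_def)
  have zN: "z N = 1" by (simp add: z_def)
  have s0: "(s 0)\<^sup>2 = \<gamma> - eval_poly x p"
    using assms(2) by (simp add: s_def)
  have si: "(s i)\<^sup>2 = eval_poly x (g i)" if "i \<in> {1..m}" for i
    using that assms(1) by (simp add: s_def feasible_def)
  \<comment> \<open>the assumed bounds add up to the constant \<open>M\<close> of the last square, so its remainder has a real root\<close>
  have "Q = (\<Sum>i=1..n. (x i)\<^sup>2) + (\<gamma> - eval_poly x p) + (\<Sum>i=1..m. eval_poly x (g i))"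
    unfolding Q_def by (simp add: sum.atLeast_Suc_atMost s0 si)
  also have "\<dots> \<le> M"
    unfolding M_def using R[OF assms(1)] \<beta>[OF assms(1)] sum_mono[of "{1..m}" "\<lambda>i. eval_poly x (g i)" \<eta>]
      \<eta>[OF assms(1)] by fastforce
  finally have "Q \<le> M" .
  moreover have "Q \<ge> 0" unfolding Q_def by (intro add_nonneg_nonneg sum_nonneg) auto
  ultimately have "Q ^ d \<le> M ^ d" by (intro power_mono)
  then have w: "w ^ (2 * d) = M ^ d - Q ^ d"
    unfolding w_def using d by (intro real_root_pow_pos2) auto
  have hom: "eval_poly z (homogenize N (2 * d) q) = eval_poly x q"
    if "q \<in> polys n" "total_deg q \<le> 2 * d" for q
    using eval_homogenize[OF that(2), of z N] eval_cong[OF that(1) zx] by (simp add: zN)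
  have "eval_poly z (f \<gamma>) = 0"
    unfolding eval_f zN zw using hom[OF p deg_p] zs[of 0] s0
    by (simp add: hom[OF g deg_g] zs zx si w M_def[symmetric] Q_def[symmetric] del: add_Suc_right add_Suc One_nat_def)
  moreover have "N \<in> {1..N}" by simp
  ultimately show ?thesis
    using pos_defD[of N "f \<gamma>" N z] zN by auto
qed

lemma l_bound_eq:
  "l_bound n m d R \<eta> \<beta> p g r
    = (SUP \<gamma>\<in>{\<gamma>. f \<gamma> - Cst (1 / real r) * sqnorm N ^ (2 * d) \<in> A_set N (2 * (2 * d)) r}. ereal \<gamma>)"
  unfolding l_bound_def Let_def sqnorm_def by (intro arg_cong[of _ _ Sup]) auto

lemma l_bound_le_opt_val:
  assumes "r \<ge> 1"
  shows "l_bound n m d R \<eta> \<beta> p g r \<le> opt_val n m p g"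
  unfolding l_bound_eq opt_val_def
proof (intro SUP_least INF_greatest)
  fix \<gamma> x
  assume "\<gamma> \<in> {\<gamma>. f \<gamma> - Cst (1 / real r) * sqnorm N ^ (2 * d) \<in> A_set N (2 * (2 * d)) r}"
  then have "pos_def N (f \<gamma>)"
    using pos_def_of_A_set assms by blast
  moreover assume "x \<in> feasible n m g"
  ultimately show "ereal \<gamma> \<le> ereal (eval_poly x p)"
    using f_not_pos_def by (meson ereal_less_eq(3) linear)
qed

lemma l_bound_mono: "mono_on {1..} (l_bound n m d R \<eta> \<beta> p g)"
proof (rule mono_onI)
  fix r r' :: nat assume r: "r \<in> {1..}" "r \<le> r'"
  have "f \<gamma> - Cst (1 / real r') * sqnorm N ^ (2 * d) \<in> A_set N (2 * (2 * d)) r'"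
    if "f \<gamma> - Cst (1 / real r) * sqnorm N ^ (2 * d) \<in> A_set N (2 * (2 * d)) r" for \<gamma>
    using A_set_mono[OF that, of r' r'] r by simp
  then show "l_bound n m d R \<eta> \<beta> p g r \<le> l_bound n m d R \<eta> \<beta> p g r'"
    unfolding l_bound_eq by (intro SUP_subset_mono) auto
qed

lemma l_bound_eventually_ge:
  assumes "ereal \<gamma> < opt_val n m p g"
  shows "eventually (\<lambda>r. ereal \<gamma> \<le> l_bound n m d R \<eta> \<beta> p g r) sequentially"
proof -
  obtain r0 where "\<And>r. r \<ge> r0 \<Longrightarrow>
      f \<gamma> - Cst (1 / real r) * sqnorm N ^ (2 * d) \<in> A_set N (2 * (2 * d)) r"
    using pos_def_eventually_in_A_set[OF _ f_forms f_pos_def[OF assms]] by auto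
  then have "ereal \<gamma> \<le> l_bound n m d R \<eta> \<beta> p g r" if "r \<ge> r0" for r
    unfolding l_bound_eq using that by (intro SUP_upper) simp
  then show ?thesis
    unfolding eventually_sequentially by blast
qed

lemma l_bound_tendsto: "l_bound n m d R \<eta> \<beta> p g \<longlonglongrightarrow> opt_val n m p g"
proof (rule order_tendstoI)
  fix a assume "a < opt_val n m p g"
  then obtain \<gamma> where \<gamma>: "a < ereal \<gamma>" "ereal \<gamma> < opt_val n m p g"
    using ereal_dense2 by blast
  show "eventually (\<lambda>r. a < l_bound n m d R \<eta> \<beta> p g r) sequentially"
    using l_bound_eventually_ge[OF \<gamma>(2)] by eventually_elim (use \<gamma>(1) in simp)
next
  fix a assume "opt_val n m p g < a"
  then show "eventually (\<lambda>r. l_bound n m d R \<eta> \<beta> p g r < a) sequentially"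
    unfolding eventually_sequentially using l_bound_le_opt_val by (meson le_less_trans)
qed

end

theorem theorem4p3p4:
  fixes n m d :: nat
    and p :: rpoly and g :: "nat \<Rightarrow> rpoly"
    and R \<beta> :: real and \<eta> :: "nat \<Rightarrow> real"
  assumes "p \<in> polys n"
    and "\<forall>i\<in>{1..m}. g i \<in> polys n"
    and "d \<ge> 1"
    and "2 * d = (LEAST k. 0 < k \<and> even k \<and> total_deg p \<le> k \<and> (\<forall>i\<in>{1..m}. total_deg (g i) \<le> k))"
    and "R > 0"
    and "\<forall>x\<in>feasible n m g. (\<Sum>i=1..n. (x i)\<^sup>2) \<le> R"
    and "\<forall>x\<in>feasible n m g. \<forall>i\<in>{1..m}. eval_poly x (g i) \<le> \<eta> i"
    and "\<forall>x\<in>feasible n m g. - eval_poly x p \<le> \<beta>"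
  shows "(\<forall>r\<ge>1. l_bound n m d R \<eta> \<beta> p g r \<le> opt_val n m p g)
       \<and> mono_on {1..} (l_bound n m d R \<eta> \<beta> p g)
       \<and> l_bound n m d R \<eta> \<beta> p g \<longlonglongrightarrow> opt_val n m p g"
proof -
  let ?P = "\<lambda>k. 0 < k \<and> even k \<and> total_deg p \<le> k \<and> (\<forall>i\<in>{1..m}. total_deg (g i) \<le> k)"
  \<comment> \<open>some even bound on the degrees exists, so the least one is a bound as well\<close>
  have "?P (2 * (1 + total_deg p + (\<Sum>i\<in>{1..m}. total_deg (g i))))"
  proof -
    have "total_deg (g i) \<le> (\<Sum>i\<in>{1..m}. total_deg (g i))" if "i \<in> {1..m}" for i
      using that by (intro member_le_sum) auto
    then show ?thesis by fastforce
  qed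
  then have "?P (LEAST k. ?P k)"
    by (rule LeastI)
  then have "?P (2 * d)"
    unfolding assms(4)[symmetric] .
  then interpret bounded_problem n m d p g R \<beta> \<eta>
    using assms by unfold_locales auto
  show ?thesis
    using l_bound_le_opt_val l_bound_mono l_bound_tendsto by blast
qed

end
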